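(* Fix $0<\gamma<1-\gamma'<1$ and $\eta>0$. There exists $\varepsilon=\varepsilon(\gamma,\gamma',\eta)>0$ such that for every Borel set $A\subseteq[0,1]^2$ with $\lambda(A)\in[\gamma,1-\gamma']$ there exists a bijection $\phi:[0,1]^2\to[0,1]^2$ such that (1) $\phi$ is $(1+\eta)$-bi-Lipschitz, i.e. $\frac{1}{1+\eta}|x-y|\le|\phi(x)-\phi(y)|\le(1+\eta)|x-y|$ for all $x,y\in[0,1]^2$; (2) $\phi(x)=x$ for all $x\in\partial[0,1]^2$; (3) $\lambda(\phi(A))\ge\lambda(A)+\varepsilon$.
   Context: $\lambda$ denotes two-dimensional Lebesgue measure; $|\cdot|$ is the Euclidean norm on $\mathbb{R}^2$. *)

theory Defs
  imports "HOL-Analysis.Analysis"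
begin

text \<open>The unit square [0,1]^2 in R^2 = real * real (norm on the product is Euclidean).\<close>
definition unit_square :: "(real \<times> real) set" where
  "unit_square = cbox (0,0) (1,1)"

definition bi_lipschitz_on :: "real \<Rightarrow> ('a::metric_space) set \<Rightarrow> ('a \<Rightarrow> 'a) \<Rightarrow> bool" where
  "bi_lipschitz_on L S f \<longleftrightarrow>
     (\<forall>x\<in>S. \<forall>y\<in>S. dist x y / L \<le> dist (f x) (f y) \<and> dist (f x) (f y) \<le> L * dist x y)"

end

theory Submission
  imports Defs
begin

text \<open>
  To first order, \<open>x \<mapsto> x + \<delta> v(x)\<close> changes the area of \<open>A\<close> by \<open>\<delta> \<integral>\<^sub>A div v\<close>, so one wants a
  Lipschitz field, vanishing on the boundary, with \<open>div v \<approx> 1\<^sub>A - \<lambda>(A)\<close>. Lipschitz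
  bounds uniform in \<open>A\<close> are not available for this equation, but uniform bounds on \<open>\<integral>|Dv|\<^sup>2\<close> are: approximate \<open>1\<^sub>A\<close> by a
  cosine polynomial, solve the Neumann problem for the Laplacian explicitly, and cut off the gradient of the
  solution near the boundary. By the weak type inequality for the maximal function, \<open>v\<close> is
  \<open>O(K)\<close>-Lipschitz off a set \<open>E\<close> of measure \<open>O(K\<^sup>-\<^sup>2)\<close>. Replace \<open>v\<close> on \<open>E\<close> by a Lipschitz extension and
  take \<open>\<delta>\<close> a small multiple of \<open>1/K\<close>: the gain is of order \<open>1/K\<close>, the losses are \<open>O(K\<^sup>-\<^sup>2)\<close>, and a
  large fixed \<open>K\<close> works for all \<open>A\<close>.
\<close>

section \<open>Change of variables in the plane\<close>

text \<open>The exponent 2 decides the balance. An L^1 bound on Dv would only give E of measure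
  O(1/K), the same order as the gain; an L^2 bound gives O(K^-2), and it also controls the second
  order term \<delta>^2 det Dv of the Jacobian. Uniformity in A comes from Fourier multipliers:
  Parseval bounds the second derivatives of the potential by the L^2 norm of the cosine polynomial,
  whatever its degree, and with polynomials all derivatives are classical.

  Nothing is known about the Jacobian of the modified map on E, so the image of the part of A in E
  is discarded, at a cost of a multiple of the measure of E. The boundary has to stay fixed, so the
  extension must start from a field that is prescribed as 0 outside the open square. The Lipschitz
  bound is therefore also required between a good point and an exterior point, and the convexity of
  the square supplies it.

  The first order gain is the integral over A of 1_A - \<lambda>(A), which is \<lambda>(A) (1 -
  \<lambda>(A)) and at least \<gamma> \<gamma>'.\<close>

definition vec2_of_pair :: "real \<times> real \<Rightarrow> real^2" where
  "vec2_of_pair z = vector [fst z, snd z]"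

definition pair_of_vec2 :: "real^2 \<Rightarrow> real \<times> real" where
  "pair_of_vec2 u = (u $ 1, u $ 2)"

lemma pair_of_vec2_inverse [simp]: "pair_of_vec2 (vec2_of_pair z) = z"
  by (simp add: vec2_of_pair_def pair_of_vec2_def)

lemma vec2_of_pair_inverse [simp]: "vec2_of_pair (pair_of_vec2 u) = u"
  by (simp add: vec2_of_pair_def pair_of_vec2_def vec_eq_iff forall_2)

lemma bounded_linear_vec2_of_pair: "bounded_linear vec2_of_pair"
proof (rule linear_conv_bounded_linear[THEN iffD1], rule linearI)
qed (auto simp: vec2_of_pair_def vec_eq_iff forall_2)

lemma bounded_linear_pair_of_vec2: "bounded_linear pair_of_vec2"
proof (rule linear_conv_bounded_linear[THEN iffD1], rule linearI)
qed (auto simp: pair_of_vec2_def)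

lemma vec2_of_pair_measurable [measurable]: "vec2_of_pair \<in> borel_measurable borel"
  using bounded_linear_vec2_of_pair
  by (intro borel_measurable_continuous_onI linear_continuous_on) 

lemma pair_of_vec2_measurable [measurable]: "pair_of_vec2 \<in> borel_measurable borel"
  using bounded_linear_pair_of_vec2
  by (intro borel_measurable_continuous_onI linear_continuous_on) 

lemma vec2_of_pair_image: "vec2_of_pair ` S = pair_of_vec2 -` S"
  by (auto simp: image_iff) (metis vec2_of_pair_inverse)

text \<open>Lebesgue measure is determined by its values on boxes, so it suffices to compare those.
  This lets areas be moved between \<open>real \<times> real\<close> and
  \<open>real^2\<close>.\<close>

lemma lborel_vec2_of_pair: "distr lborel borel vec2_of_pair = lborel"
proof (rule lborel_eqI[symmetric])
  fix l u :: "real^2"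
  assume le: "\<And>b. b \<in> Basis \<Longrightarrow> l \<bullet> b \<le> u \<bullet> b"
  have l: "l $ i \<le> u $ i" for i
    using le[of "axis i 1"] by (simp add: inner_axis axis_in_Basis_iff)
  have "vec2_of_pair -` box l u = box (pair_of_vec2 l) (pair_of_vec2 u)"
    by (auto simp: mem_box_cart vec2_of_pair_def pair_of_vec2_def forall_2 mem_box Basis_prod_def)
  moreover have "emeasure lborel (box (pair_of_vec2 l) (pair_of_vec2 u)) = ennreal ((u $ 1 - l $ 1) * (u $ 2 - l $ 2))"
    using l unfolding pair_of_vec2_def
    by (subst emeasure_lborel_box) (auto simp: Basis_prod_def prod.union_disjoint inner_diff_left image_iff)
  moreover have "(\<Prod>b\<in>Basis. (u - l) \<bullet> b) = (u $ 1 - l $ 1) * (u $ 2 - l $ 2)"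
    unfolding Basis_vec_def by (simp add: UNIV_2 inner_axis axis_eq_axis)
  ultimately show "emeasure (distr lborel borel vec2_of_pair) (box l u) = (\<Prod>b\<in>Basis. (u - l) \<bullet> b)"
    by (subst emeasure_distr) auto
qed simp

lemma measure_lborel_vec2_of_pair:
  assumes "S \<in> sets borel"
  shows "measure lborel (vec2_of_pair ` S) = measure lborel S"
proof -
  have "pair_of_vec2 -` S \<inter> space borel \<in> sets borel"
    using assms by measurable
  hence *: "vec2_of_pair ` S \<in> sets borel"
    by (simp add: vec2_of_pair_image)
  have "measure lborel (vec2_of_pair ` S) = measure (distr lborel borel vec2_of_pair) (vec2_of_pair ` S)"
    by (simp add: lborel_vec2_of_pair)
  also have "\<dots> = measure lborel (vec2_of_pair -` (vec2_of_pair ` S))"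
    using * by (subst measure_distr) auto
  also have "vec2_of_pair -` (vec2_of_pair ` S) = S"
    by (auto) (metis pair_of_vec2_inverse)
  finally show ?thesis .
qed

text \<open>Transport along the measure preserving identification with \<open>real^2\<close>, where
  the Jacobian is a matrix determinant. \<open>S\<close> is just a Borel set, since the formula is
  meant for \<open>A - E\<close>, which need not be open.\<close>

lemma measure_image_eq_integral_det:
  fixes f :: "real \<times> real \<Rightarrow> real \<times> real"
  assumes S: "S \<in> sets borel" and fS: "f ` S \<in> sets borel"
    and der: "\<And>z. z \<in> S \<Longrightarrow> (f has_derivative (\<lambda>(s,t). (a z * s + b z * t, c z * s + d z * t))) (at z)"
    and inj: "inj_on f S"
    and int: "set_integrable lborel S (\<lambda>z. a z * d z - b z * c z)"
  shows "measure lborel (f ` S) = (LINT z:S|lborel. \<bar>a z * d z - b z * c z\<bar>)"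
proof -
  let ?J = "\<lambda>z. \<bar>a z * d z - b z * c z\<bar>"
  define g where "g = vec2_of_pair \<circ> f \<circ> pair_of_vec2"
  define g' where "g' = (\<lambda>u. vec2_of_pair \<circ> (\<lambda>(s,t). (a (pair_of_vec2 u) * s + b (pair_of_vec2 u) * t,
      c (pair_of_vec2 u) * s + d (pair_of_vec2 u) * t)) \<circ> pair_of_vec2)"
  let ?S = "vec2_of_pair ` S"
  have bS: "?S \<in> sets borel"
    using measurable_sets[OF pair_of_vec2_measurable S] by (simp add: vec2_of_pair_image)
  have dg: "(g has_derivative g' u) (at u within ?S)" if "u \<in> ?S" for u
  proof -
    have "pair_of_vec2 u \<in> S" using that by auto
    from der[OF this] show ?thesis
      unfolding g_def g'_def
      by (intro diff_chain_within bounded_linear_imp_has_derivative bounded_linear_vec2_of_pair bounded_linear_pair_of_vec2)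
        (auto intro: has_derivative_at_withinI)
  qed
  have ig: "inj_on g ?S"
    using inj by (auto simp: inj_on_def g_def) (metis pair_of_vec2_inverse)
  have det: "\<bar>det (matrix (g' u))\<bar> = ?J (pair_of_vec2 u)" for u
    by (simp add: det_2 matrix_def g'_def vec2_of_pair_def pair_of_vec2_def axis_def)
  have gS: "g ` ?S = vec2_of_pair ` (f ` S)"
    by (auto simp: g_def image_iff)
  have intJ: "integrable lborel (\<lambda>z. indicator S z *\<^sub>R ?J z)"
    using set_integrable_abs[OF int] by (simp add: set_integrable_def)
  hence "integrable (distr lborel borel vec2_of_pair) (\<lambda>u. indicator S (pair_of_vec2 u) *\<^sub>R ?J (pair_of_vec2 u))"
    by (subst integrable_distr_eq) (auto)
  hence "integrable lborel (\<lambda>u. indicator ?S u *\<^sub>R ?J (pair_of_vec2 u))"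
    by (simp add: lborel_vec2_of_pair vec2_of_pair_image indicator_vimage[symmetric])
  hence si: "set_integrable lborel ?S (\<lambda>u. ?J (pair_of_vec2 u))"
    by (simp add: set_integrable_def)
  have eq: "(LINT u:?S|lborel. ?J (pair_of_vec2 u)) = (LINT z:S|lborel. ?J z)"
  proof -
    have "(LINT u:?S|lborel. ?J (pair_of_vec2 u)) = (LINT u|distr lborel borel vec2_of_pair. indicator S (pair_of_vec2 u) *\<^sub>R ?J (pair_of_vec2 u))"
      by (simp add: set_lebesgue_integral_def lborel_vec2_of_pair vec2_of_pair_image indicator_vimage[symmetric])
    also have "\<dots> = (LINT z|lborel. indicator S z *\<^sub>R ?J z)"
    proof (subst integral_distr)
      show "(\<lambda>u. indicator S (pair_of_vec2 u) *\<^sub>R ?J (pair_of_vec2 u)) \<in> borel_measurable borel"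
        using borel_measurable_integrable[OF intJ] by measurable
    qed auto
    finally show ?thesis by (simp add: set_lebesgue_integral_def)
  qed
  have "(\<lambda>u. \<bar>det (matrix (g' u))\<bar>) integrable_on ?S"
    using set_borel_integral_eq_integral(1)[OF si] by (simp add: det)
  hence "measure lebesgue (g ` ?S) = integral ?S (\<lambda>u. \<bar>det (matrix (g' u))\<bar>)"
    using bS by (intro measure_differentiable_image_eq dg ig) auto
  also have "\<dots> = (LINT u:?S|lborel. ?J (pair_of_vec2 u))"
    using set_borel_integral_eq_integral(2)[OF si] by (simp add: det)
  finally have "measure lebesgue (vec2_of_pair ` (f ` S)) = (LINT z:S|lborel. ?J z)"
    by (simp add: eq gS)
  moreover have "vec2_of_pair ` (f ` S) \<in> sets borel"
    using measurable_sets[OF pair_of_vec2_measurable fS] by (simp add: vec2_of_pair_image)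
  ultimately show ?thesis
    using measure_lborel_vec2_of_pair[OF fS] by (simp add: measure_completion)
qed

section \<open>Lipschitz truncation of Sobolev fields\<close>

lemma cball_in_sets_borel [measurable, simp]: "cball (c::'a::metric_space) r \<in> sets borel"
  by (rule borel_closed) simp

lemma emeasure_cball_scale:
  fixes c d :: "'a::euclidean_space"
  assumes "0 \<le> r" "0 \<le> s"
  shows "emeasure lborel (cball c (s * r)) = ennreal (s ^ DIM('a)) * emeasure lborel (cball d r)"
  using assms by (simp add: emeasure_cball power_mult_distrib ennreal_mult'[symmetric] mult_ac)

text \<open>\<open>E\<close> consists of the five-fold enlargements of a disjoint Vitali subfamily
  of the balls on which the average of \<open>h\<close> exceeds \<open>c\<close>. Disjointness
  bounds the total volume of the subfamily by the integral of \<open>h\<close> divided by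
  \<open>c\<close>, and the enlargement costs \<open>5 ^ DIM('a)\<close>. With the result phrased
  through a Borel set \<open>E\<close>, the measurability of the maximal function does not come
  up.\<close>

lemma maximal_function_weak_type:
  fixes h :: "'a::euclidean_space \<Rightarrow> ennreal"
  assumes h [measurable]: "h \<in> borel_measurable borel"
    and fin: "(\<integral>\<^sup>+ z. h z \<partial>lborel) < \<infinity>" and c: "0 < c"
  obtains E where "E \<in> sets borel"
    "emeasure lborel E * ennreal c \<le> 5 ^ DIM('a) * (\<integral>\<^sup>+ z. h z \<partial>lborel)"
    "\<And>x r. x \<notin> E \<Longrightarrow> 0 < r \<Longrightarrow>
       (\<integral>\<^sup>+ z. h z * indicator (cball x r) z \<partial>lborel) \<le> ennreal c * emeasure lborel (cball x r)"
proof -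
  let ?n = "DIM('a)"
  let ?V = "unit_ball_vol ?n"
  define I where "I = (\<integral>\<^sup>+ z. h z \<partial>lborel)"
  define K where "K = {(x::'a, r). 0 < r \<and>
    ennreal c * emeasure lborel (cball x r) < (\<integral>\<^sup>+ z. h z * indicator (cball x r) z \<partial>lborel)}"
  \<comment> \<open>Vitali's lemma needs bounded radii. On a bad ball, \<open>c\<close> times the
    volume is below the integral of \<open>h\<close>, which bounds \<open>r ^ DIM('a)\<close>;
    \<open>max 1\<close> covers the radii up to 1, for which \<open>r \<le> r ^ DIM('a)\<close> may
    fail.\<close>
  define B where "B = max 1 (enn2real I / (c * ?V))"
  have bd: "0 < snd i \<and> snd i \<le> B" if "i \<in> K" for i
  proof -
    obtain x r where i: "i = (x, r)" by fastforce
    have r: "0 < r" and gt: "ennreal c * emeasure lborel (cball x r) < (\<integral>\<^sup>+ z. h z * indicator (cball x r) z \<partial>lborel)"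
      using that by (auto simp: K_def i)
    note gt
    also have "(\<integral>\<^sup>+ z. h z * indicator (cball x r) z \<partial>lborel) \<le> I"
      unfolding I_def by (intro nn_integral_mono) (auto simp: indicator_def)
    also have "I = ennreal (enn2real I)"
      using fin by (simp add: I_def)
    also have "ennreal c * emeasure lborel (cball x r) = ennreal (c * (?V * r ^ ?n))"
      using r c by (simp add: emeasure_cball ennreal_mult' del: times_divide_eq_left)
    finally have "c * (?V * r ^ ?n) < enn2real I"
      using c r by (subst (asm) ennreal_less_iff) (auto intro!: mult_nonneg_nonneg)
    hence *: "r ^ ?n \<le> enn2real I / (c * ?V)"
      using c by (simp add: field_simps)
    have "r \<le> B"
    proof (cases "r \<le> 1")
      case False
      hence "r ^ 1 \<le> r ^ ?n"
        by (intro power_increasing) (auto simp: Suc_le_eq)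
      with * show ?thesis by (simp add: B_def)
    qed (simp add: B_def)
    with r show ?thesis by (simp add: i)
  qed
  obtain C where C: "countable C" "C \<subseteq> K"
    "pairwise (\<lambda>i j. disjnt (cball (fst i) (snd i)) (cball (fst j) (snd j))) C"
    "(\<Union>i\<in>K. cball (fst i) (snd i)) \<subseteq> (\<Union>i\<in>C. cball (fst i) (5 * snd i))"
    by (rule Vitali_covering_lemma_cballs[OF order_refl bd, where a = fst]) auto
  define E where "E = (\<Union>i\<in>C. cball (fst i) (5 * snd i))"
  have rpos: "0 < snd i" if "i \<in> C" for i
    using that C(2) bd[of i] by blast
  show thesis
  proof
    show Eb: "E \<in> sets borel"
      unfolding E_def using C(1) by (intro sets.countable_UN') auto
    show "emeasure lborel E * ennreal c \<le> 5 ^ ?n * (\<integral>\<^sup>+ z. h z \<partial>lborel)"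
    proof -
      have "emeasure lborel E = (\<integral>\<^sup>+ z. indicator E z \<partial>lborel)"
        using Eb by simp
      \<comment> \<open>Countable subadditivity, with the sum over \<open>C\<close> written as an
        integral against counting measure so that the two integrals can be exchanged.\<close>
      also have "\<dots> \<le> (\<integral>\<^sup>+ z. (\<integral>\<^sup>+ i. indicator (cball (fst i) (5 * snd i)) z \<partial>count_space C) \<partial>lborel)"
      proof (intro nn_integral_mono)
        fix z :: 'a
        show "indicator E z \<le> (\<integral>\<^sup>+ i. indicator (cball (fst i) (5 * snd i)) z \<partial>count_space C)"
        proof (cases "z \<in> E")
          case True
          then obtain i where i: "i \<in> C" "z \<in> cball (fst i) (5 * snd i)" by (auto simp: E_def)
          have "indicator E z = (\<integral>\<^sup>+ j. indicator {i} j \<partial>count_space C)"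
            using i True by (simp)
          also have "\<dots> \<le> (\<integral>\<^sup>+ i. indicator (cball (fst i) (5 * snd i)) z \<partial>count_space C)"
            using i by (intro nn_integral_mono) (auto simp: indicator_def)
          finally show ?thesis .
        qed simp
      qed
      also have "\<dots> = (\<integral>\<^sup>+ i. emeasure lborel (cball (fst i) (5 * snd i)) \<partial>count_space C)"
        using C(1) by (subst nn_integral_count_space_nn_integral) auto
      also have "\<dots> = (\<integral>\<^sup>+ i. 5 ^ ?n * emeasure lborel (cball (fst i) (snd i)) \<partial>count_space C)"
      proof (intro nn_integral_cong)
        fix i assume "i \<in> space (count_space C)"
        hence "0 \<le> snd i" using rpos[of i] by simp
        from emeasure_cball_scale[OF this, of 5]
        show "emeasure lborel (cball (fst i) (5 * snd i)) = 5 ^ ?n * emeasure lborel (cball (fst i) (snd i))"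
          by (simp flip: ennreal_power)
      qed
      finally have "emeasure lborel E * ennreal c \<le>
          (\<integral>\<^sup>+ i. 5 ^ ?n * emeasure lborel (cball (fst i) (snd i)) \<partial>count_space C) * ennreal c"
        by (intro mult_right_mono) auto
      also have "\<dots> = (\<integral>\<^sup>+ i. 5 ^ ?n * (ennreal c * emeasure lborel (cball (fst i) (snd i))) \<partial>count_space C)"
        by (subst nn_integral_multc[symmetric]) (auto simp: mult_ac)
      \<comment> \<open>The inequality that defines a bad ball bounds its volume by its mass for the
        density \<open>h\<close>; for that measure the disjoint balls together have at most the
        total mass.\<close>
      also have "\<dots> \<le> (\<integral>\<^sup>+ i. 5 ^ ?n * emeasure (density lborel h) (cball (fst i) (snd i)) \<partial>count_space C)"
      proof (intro nn_integral_mono mult_left_mono)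
        fix i assume "i \<in> space (count_space C)"
        hence "i \<in> K" using C(2) by auto
        thus "ennreal c * emeasure lborel (cball (fst i) (snd i)) \<le> emeasure (density lborel h) (cball (fst i) (snd i))"
          by (subst emeasure_density) (auto simp: K_def)
      qed auto
      also have "\<dots> = 5 ^ ?n * (\<integral>\<^sup>+ i. emeasure (density lborel h) (cball (fst i) (snd i)) \<partial>count_space C)"
        by (rule nn_integral_cmult) auto
      also have "(\<integral>\<^sup>+ i. emeasure (density lborel h) (cball (fst i) (snd i)) \<partial>count_space C) =
          emeasure (density lborel h) (\<Union>i\<in>C. cball (fst i) (snd i))"
        using C(1,3) by (subst emeasure_UN_countable) (auto simp: disjoint_family_on_def pairwise_def disjnt_def)
      also have "\<dots> \<le> emeasure (density lborel h) UNIV"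
        by (rule emeasure_mono) auto
      also have "\<dots> = I"
        unfolding I_def by (subst emeasure_density) auto
      finally show ?thesis
        unfolding I_def by (simp add: mult_left_mono)
    qed
    fix x and r :: real assume xE: "x \<notin> E" and r: "0 < r"
    show "(\<integral>\<^sup>+ z. h z * indicator (cball x r) z \<partial>lborel) \<le> ennreal c * emeasure lborel (cball x r)"
    proof (rule ccontr)
      assume "\<not> ?thesis"
      hence "(x, r) \<in> K" using r by (auto simp: K_def not_le)
      hence "x \<in> (\<Union>i\<in>K. cball (fst i) (snd i))"
        using r by (intro UN_I[of "(x, r)"]) auto
      with C(4) have "x \<in> E" unfolding E_def by blast
      with xE show False by simp
    qed
  qed
qed

section \<open>Lipschitz bounds for a zero extension where the maximal function is small\<close>

lemma nn_integral_cball_dilate: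
  fixes x :: "'a::euclidean_space" and F :: "'a \<Rightarrow> ennreal"
  assumes [measurable]: "F \<in> borel_measurable borel" and t: "0 < t"
  shows "(\<integral>\<^sup>+ u. F u * indicator (cball x (t * R)) u \<partial>lborel) =
    ennreal (t ^ DIM('a)) * (\<integral>\<^sup>+ z. F (x + t *\<^sub>R (z - x)) * indicator (cball x R) z \<partial>lborel)"
proof -
  have mem: "(x + t *\<^sub>R (z - x) \<in> cball x (t * R)) = (z \<in> cball x R)" for z
    using t by (simp add: dist_norm norm_minus_commute)
  have "(\<integral>\<^sup>+ u. F u * indicator (cball x (t * R)) u \<partial>lborel) =
    (\<integral>\<^sup>+ u. F u * indicator (cball x (t * R)) u
       \<partial>density (distr lborel borel (\<lambda>z. (x - t *\<^sub>R x) + t *\<^sub>R z)) (\<lambda>_. \<bar>t\<bar> ^ DIM('a)))"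
    using t by (subst lborel_affine[of t "x - t *\<^sub>R x"]) auto
  also have "\<dots> = (\<integral>\<^sup>+ z. ennreal (t ^ DIM('a)) * (F (x + t *\<^sub>R (z - x)) *
      indicator (cball x (t * R)) (x + t *\<^sub>R (z - x))) \<partial>lborel)"
    using t by (subst nn_integral_density; (subst nn_integral_distr)?) (measurable, auto simp: algebra_simps)
  also have "\<dots> = ennreal (t ^ DIM('a)) * (\<integral>\<^sup>+ z. F (x + t *\<^sub>R (z - x)) *
      indicator (cball x (t * R)) (x + t *\<^sub>R (z - x)) \<partial>lborel)"
    by (rule nn_integral_cmult) auto
  also have "(\<lambda>z. indicator (cball x (t * R)) (x + t *\<^sub>R (z - x)) :: ennreal) = indicator (cball x R)"
    using mem by (auto simp: indicator_def fun_eq_iff)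
  finally show ?thesis by (simp add: fun_eq_iff)
qed

text \<open>A lower bound valid on a ball is at most the average there. The integral is compared
  with a ball \<open>s\<close> times as large, and the ratio of volumes is the source of the factors
  \<open>2 ^ DIM('a)\<close> and \<open>8 ^ DIM('a)\<close> in the Lipschitz constants.\<close>

lemma le_of_average_le:
  fixes c :: "'a::euclidean_space" and F :: "'a \<Rightarrow> real"
  assumes le: "\<And>z. z \<in> cball c r \<Longrightarrow> d \<le> F z" and d: "0 \<le> d" and [measurable]: "F \<in> borel_measurable borel"
    and r: "0 < r" and M: "0 \<le> M"
    and int: "(\<integral>\<^sup>+ z. ennreal (F z) * indicator (cball c r) z \<partial>lborel) \<le> ennreal M * emeasure lborel (cball c (s * r))"
    and s: "0 \<le> s"
  shows "d \<le> M * s ^ DIM('a)"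
proof -
  have "ennreal d * emeasure lborel (cball c r) = (\<integral>\<^sup>+ z. ennreal d * indicator (cball c r) z \<partial>lborel)"
    by (subst nn_integral_cmult) auto
  also have "\<dots> \<le> (\<integral>\<^sup>+ z. ennreal (F z) * indicator (cball c r) z \<partial>lborel)"
    using le by (intro nn_integral_mono) (auto simp: indicator_def intro!: ennreal_leI)
  also note int
  also have "ennreal M * emeasure lborel (cball c (s * r)) = ennreal (M * s ^ DIM('a)) * emeasure lborel (cball c r)"
    using r s M by (subst emeasure_cball_scale[where d = c]) (auto simp: ennreal_mult mult_ac)
  finally have *: "ennreal d * emeasure lborel (cball c r) \<le> ennreal (M * s ^ DIM('a)) * emeasure lborel (cball c r)" .
  have "emeasure lborel (cball c r) = ennreal (unit_ball_vol DIM('a) * r ^ DIM('a))"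
    using r by (simp add: emeasure_cball)
  moreover have "0 < unit_ball_vol DIM('a) * r ^ DIM('a)"
    using r by simp
  ultimately have "d * (unit_ball_vol DIM('a) * r ^ DIM('a)) \<le> M * s ^ DIM('a) * (unit_ball_vol DIM('a) * r ^ DIM('a))"
    using * d M s by (simp flip: ennreal_mult' add: ennreal_le_iff)
  thus ?thesis
    using \<open>0 < unit_ball_vol DIM('a) * r ^ DIM('a)\<close> by (rule mult_right_le_imp_le)
qed

text \<open>Classical derivatives stand in for weak ones: \<open>v\<close> is differentiable
  everywhere, and only its zero extension may have a kink at the frontier of \<open>Q\<close>. The
  function \<open>g\<close> is a continuous bound for the operator norm of the derivative.\<close>

locale vanishing_field =
  fixes v :: "'a::euclidean_space \<Rightarrow> 'b::euclidean_space" and D :: "'a \<Rightarrow> 'a \<Rightarrow> 'b"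
    and g :: "'a \<Rightarrow> real" and Q :: "'a set"
  assumes der: "\<And>z. (v has_derivative D z) (at z)"
    and D_le: "\<And>z u. norm (D z u) \<le> g z * norm u"
    and cont_g: "continuous_on UNIV g" and g_nonneg: "\<And>z. 0 \<le> g z"
    and convex_Q: "convex Q" and closed_Q: "closed Q" and interior_Q: "interior Q \<noteq> {}"
    and vanish: "\<And>z. z \<in> frontier Q \<Longrightarrow> v z = 0"
begin

definition w :: "'a \<Rightarrow> 'b" where "w z = (if z \<in> Q then v z else 0)"

text \<open>Fundamental theorem of calculus along the segment from \<open>x\<close> towards
  \<open>z\<close>. If \<open>z\<close> lies outside \<open>Q\<close>, the path stops at the
  frontier, where \<open>v\<close> already equals \<open>w z = 0\<close>. By convexity the part
  travelled lies in \<open>Q\<close>, so the indicator of \<open>Q\<close> may be inserted.\<close>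

lemma norm_diff_le_nn_integral_segment:
  assumes x: "x \<in> Q"
  shows "ennreal (norm (w z - w x)) \<le>
    ennreal (norm (z - x)) * (\<integral>\<^sup>+ t. ennreal (g (x + t *\<^sub>R (z - x))) *
       indicator Q (x + t *\<^sub>R (z - x)) * indicator {0..1} t \<partial>lborel)"
proof -
  let ?p = "\<lambda>t. x + t *\<^sub>R (z - x)"
  obtain s where s: "0 \<le> s" "s \<le> 1" "?p s \<in> Q" "v (?p s) = w z"
  proof (cases "z \<in> Q")
    case True
    thus ?thesis using that[of 1] by (auto simp: w_def)
  next
    case False
    have "closed_segment x z \<inter> frontier Q \<noteq> {}"
      using False x by (intro connected_Int_frontier) auto
    then obtain y where y: "y \<in> closed_segment x z" "y \<in> frontier Q" by auto
    then obtain s where "0 \<le> s" "s \<le> 1" "y = (1 - s) *\<^sub>R x + s *\<^sub>R z"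
      by (auto simp: closed_segment_def)
    moreover from this have "y = ?p s" by (simp add: algebra_simps)
    moreover have "y \<in> Q" using y closed_Q by (auto simp: frontier_def)
    ultimately show ?thesis using that[of s] vanish[OF y(2)] False by (auto simp: w_def)
  qed
  have inQ: "?p t \<in> Q" if "0 \<le> t" "t \<le> s" for t
  proof (cases "s = 0")
    case False
    have "(1 - t / s) *\<^sub>R x + (t / s) *\<^sub>R ?p s \<in> Q"
      using that s x convex_Q False by (intro convexD) (auto simp: field_simps)
    also have "(1 - t / s) *\<^sub>R x + (t / s) *\<^sub>R ?p s = ?p t"
      using False by (simp add: algebra_simps)
    finally show ?thesis .
  qed (use that x in auto)
  have vd: "((\<lambda>t. v (?p t)) has_vector_derivative D (?p t) (z - x)) (at t within {0..s})" for t
  proof -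
    have "(?p has_vector_derivative (z - x)) (at t within {0..s})"
      by (auto intro!: derivative_eq_intros)
    moreover have "(v has_derivative D (?p t)) (at (?p t) within ?p ` {0..s})"
      using der by (rule has_derivative_at_withinI)
    ultimately show ?thesis
      by (rule vector_derivative_diff_chain_within[unfolded o_def])
  qed
  have hi: "((\<lambda>t. D (?p t) (z - x)) has_integral (v (?p s) - v (?p 0))) {0..s}"
    using s vd by (intro fundamental_theorem_of_calculus) auto
  have cg: "continuous_on {0..s} (\<lambda>t. g (?p t))"
    by (intro continuous_on_compose2[OF cont_g] continuous_intros) auto
  have "norm (w z - w x) = norm (integral {0..s} (\<lambda>t. D (?p t) (z - x)))"
    using integral_unique[OF hi] s(4) x by (simp add: w_def)
  also have "\<dots> \<le> integral {0..s} (\<lambda>t. g (?p t) * norm (z - x))"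
  proof (rule Henstock_Kurzweil_Integration.integral_norm_bound_integral)
    show "(\<lambda>t. D (?p t) (z - x)) integrable_on {0..s}"
      using hi by blast
    show "(\<lambda>t. g (?p t) * norm (z - x)) integrable_on {0..s}"
      using cg by (intro integrable_continuous_real continuous_intros)
  qed (rule D_le)
  also have "\<dots> = norm (z - x) * integral {0..s} (\<lambda>t. g (?p t))"
    by (simp add: mult.commute)
  finally have "ennreal (norm (w z - w x)) \<le> ennreal (norm (z - x) * integral {0..s} (\<lambda>t. g (?p t)))"
    by (rule ennreal_leI)
  also have "\<dots> = ennreal (norm (z - x)) * ennreal (integral {0..s} (\<lambda>t. g (?p t)))"
    by (rule ennreal_mult') simp
  also have "ennreal (integral {0..s} (\<lambda>t. g (?p t))) = (\<integral>\<^sup>+ t. ennreal (g (?p t)) * indicator {0..s} t \<partial>lborel)"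
    using cg g_nonneg by (intro nn_integral_has_integral_lebesgue'[symmetric] integrable_integral
        integrable_continuous_real) auto
  also have "\<dots> \<le> (\<integral>\<^sup>+ t. ennreal (g (?p t)) * indicator Q (?p t) * indicator {0..1} t \<partial>lborel)"
    using inQ s by (intro nn_integral_mono) (auto simp: indicator_def)
  finally show ?thesis by (simp add: mult_left_mono)
qed


lemma w_measurable [measurable]: "w \<in> borel_measurable borel"
proof -
  have "continuous_on UNIV v"
    using der by (meson has_derivative_continuous continuous_at_imp_continuous_on)
  hence [measurable]: "v \<in> borel_measurable borel" by (rule borel_measurable_continuous_onI)
  have [measurable]: "Q \<in> sets borel" using closed_Q by auto
  show ?thesis unfolding w_def[abs_def] by measurable
qed

text \<open>The points of \<open>Q\<close> at which the maximal function of \<open>g\<close>,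
  restricted to \<open>Q\<close>, is at most \<open>K\<close>.\<close>

definition good :: "real \<Rightarrow> 'a set" where
  "good K = {x \<in> Q. \<forall>r>0. (\<integral>\<^sup>+ z. ennreal (g z) * indicator Q z * indicator (cball x r) z \<partial>lborel)
     \<le> ennreal K * emeasure lborel (cball x r)}"

text \<open>A Poincare inequality at a point. The segment estimate is integrated over the ball and
  the order of integration exchanged; for fixed \<open>t\<close> the homothety with ratio
  \<open>t\<close> about \<open>x\<close> leads to the ball of radius \<open>t * R\<close>, where
  \<open>good\<close> applies. The factor \<open>t ^ DIM('a)\<close> from the substitution cancels
  against the ratio of volumes.\<close>

lemma nn_integral_oscillation_le:
  assumes x: "x \<in> good K" and K: "0 \<le> K" and R: "0 < R"
  shows "(\<integral>\<^sup>+ z. ennreal (norm (w z - w x)) * indicator (cball x R) z \<partial>lborel)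
    \<le> ennreal (R * K) * emeasure lborel (cball x R)"
proof -
  let ?G = "\<lambda>u. ennreal (g u) * indicator Q u"
  have [measurable]: "g \<in> borel_measurable borel" "Q \<in> sets borel"
    using cont_g closed_Q by (auto intro: borel_measurable_continuous_onI)
  have xQ: "x \<in> Q" using x by (simp add: good_def)
  have "(\<integral>\<^sup>+ z. ennreal (norm (w z - w x)) * indicator (cball x R) z \<partial>lborel) \<le>
    (\<integral>\<^sup>+ z. (\<integral>\<^sup>+ t. ennreal R * (?G (x + t *\<^sub>R (z - x)) * indicator (cball x R) z * indicator {0..1} t) \<partial>lborel) \<partial>lborel)"
  proof (intro nn_integral_mono)
    fix z :: 'a
    have "ennreal (norm (w z - w x)) * indicator (cball x R) z \<le>
      ennreal (norm (z - x)) * (\<integral>\<^sup>+ t. ?G (x + t *\<^sub>R (z - x)) * indicator {0..1} t \<partial>lborel) * indicator (cball x R) z"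
      using norm_diff_le_nn_integral_segment[OF xQ, of z] by (intro mult_right_mono) auto
    also have "\<dots> \<le> ennreal R * (\<integral>\<^sup>+ t. ?G (x + t *\<^sub>R (z - x)) * indicator {0..1} t \<partial>lborel) * indicator (cball x R) z"
      by (auto simp: indicator_def dist_norm norm_minus_commute intro!: mult_right_mono ennreal_leI)
    also have "\<dots> = (\<integral>\<^sup>+ t. ennreal R * (?G (x + t *\<^sub>R (z - x)) * indicator (cball x R) z * indicator {0..1} t) \<partial>lborel)"
      by (subst nn_integral_cmult[symmetric], measurable, subst nn_integral_multc[symmetric]) (auto simp: mult_ac)
    finally show "ennreal (norm (w z - w x)) * indicator (cball x R) z \<le> \<dots>" .
  qed
  also have "\<dots> = (\<integral>\<^sup>+ t. (\<integral>\<^sup>+ z. ennreal R * (?G (x + t *\<^sub>R (z - x)) * indicator (cball x R) z * indicator {0..1} t) \<partial>lborel) \<partial>lborel)"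
    by (intro lborel_pair.Fubini') measurable
  also have "\<dots> \<le> (\<integral>\<^sup>+ t. ennreal (R * K) * emeasure lborel (cball x R) * indicator {0..1::real} t \<partial>lborel)"
  proof (rule nn_integral_mono_AE)
    \<comment> \<open>At \<open>t = 0\<close> the homothety collapses the ball, so this null set is
      taken out.\<close>
    have "AE t in lborel. t \<noteq> (0::real)" by (rule AE_lborel_singleton)
    thus "AE t in lborel. (\<integral>\<^sup>+ z. ennreal R * (?G (x + t *\<^sub>R (z - x)) * indicator (cball x R) z * indicator {0..1} t) \<partial>lborel)
      \<le> ennreal (R * K) * emeasure lborel (cball x R) * indicator {0..1} t"
    proof eventually_elim
      case (elim t)
      show ?case
      proof (cases "t \<in> {0..1}")
        case True
        with elim have t: "0 < t" by auto
        let ?I = "\<integral>\<^sup>+ z. ?G (x + t *\<^sub>R (z - x)) * indicator (cball x R) z \<partial>lborel"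
        have "ennreal (t ^ DIM('a)) * ?I = (\<integral>\<^sup>+ u. ?G u * indicator (cball x (t * R)) u \<partial>lborel)"
          using t by (subst nn_integral_cball_dilate) auto
        also have "\<dots> \<le> ennreal K * emeasure lborel (cball x (t * R))"
          using x t R by (auto simp: good_def)
        also have "\<dots> = ennreal (t ^ DIM('a)) * (ennreal K * emeasure lborel (cball x R))"
          using t R by (subst emeasure_cball_scale[where d = x]) (auto simp: mult_ac)
        finally have "?I \<le> ennreal K * emeasure lborel (cball x R)"
          using t by (subst (asm) ennreal_mult_le_mult_iff) auto
        hence "ennreal R * ?I \<le> ennreal R * (ennreal K * emeasure lborel (cball x R))"
          by (rule mult_left_mono) simp
        also have "\<dots> = ennreal (R * K) * emeasure lborel (cball x R)"
          using R K by (simp add: ennreal_mult mult.assoc)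
        finally show ?thesis
          using True by (subst nn_integral_cmult) auto
      qed simp
    qed
  qed
  also have "\<dots> = ennreal (R * K) * emeasure lborel (cball x R)"
    by (subst nn_integral_cmult) auto
  finally show ?thesis .
qed

text \<open>The triangle inequality through a third point \<open>z\<close>, averaged over the ball
  whose diameter is the segment from \<open>x\<close> to \<open>y\<close>: that ball lies in the
  balls of radius \<open>dist x y\<close> about both points, where the oscillation is
  controlled.\<close>

lemma lipschitz_on_good:
  assumes x: "x \<in> good K" and y: "y \<in> good K" and K: "0 \<le> K"
  shows "norm (w x - w y) \<le> 2 * 8 ^ DIM('a) * K * dist x y"
proof (cases "x = y")
  case False
  let ?r = "dist x y"
  define c where "c = midpoint x y"
  have r: "0 < ?r" using False by simp
  have sub: "cball c (?r / 2) \<subseteq> cball x ?r" "cball c (?r / 2) \<subseteq> cball y ?r"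
    by (auto simp: c_def dist_midpoint cball_subset_cball_iff)
  let ?F = "\<lambda>z. norm (w z - w x) + norm (w z - w y)"
  have "norm (w x - w y) \<le> (2 * (?r * K)) * 2 ^ DIM('a)"
  proof (rule le_of_average_le[where c = c and r = "?r / 2" and F = ?F])
    show "norm (w x - w y) \<le> ?F z" for z
      by norm
    have "(\<integral>\<^sup>+ z. ennreal (?F z) * indicator (cball c (?r / 2)) z \<partial>lborel) \<le>
      (\<integral>\<^sup>+ z. ennreal (norm (w z - w x)) * indicator (cball x ?r) z +
             ennreal (norm (w z - w y)) * indicator (cball y ?r) z \<partial>lborel)"
      using sub by (intro nn_integral_mono) (auto simp: indicator_def)
    also have "\<dots> = (\<integral>\<^sup>+ z. ennreal (norm (w z - w x)) * indicator (cball x ?r) z \<partial>lborel) +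
       (\<integral>\<^sup>+ z. ennreal (norm (w z - w y)) * indicator (cball y ?r) z \<partial>lborel)"
      by (rule nn_integral_add) auto
    also have "\<dots> \<le> ennreal (?r * K) * emeasure lborel (cball x ?r) + ennreal (?r * K) * emeasure lborel (cball y ?r)"
      using r K x y by (intro add_mono nn_integral_oscillation_le) auto
    also have "\<dots> = ennreal (2 * (?r * K)) * emeasure lborel (cball c (2 * (?r / 2)))"
      using r K by (simp add: emeasure_cball ennreal_mult[symmetric] ennreal_plus[symmetric] del: ennreal_plus)
    finally show "(\<integral>\<^sup>+ z. ennreal (?F z) * indicator (cball c (?r / 2)) z \<partial>lborel) \<le>
        ennreal (2 * (?r * K)) * emeasure lborel (cball c (2 * (?r / 2)))" .
  qed (use r K in auto)
  \<comment> \<open>The factor \<open>2 ^ DIM('a)\<close> is enlarged to agree with the constant for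
    exterior points.\<close>
  also have "\<dots> \<le> (2 * (?r * K)) * 8 ^ DIM('a)"
    using K by (intro mult_left_mono power_mono) auto
  finally show ?thesis by (simp add: mult_ac)
qed simp

text \<open>A hyperplane separates \<open>y\<close> from the interior of \<open>Q\<close>, hence
  from \<open>Q\<close> up to equality. Moving from \<open>y\<close> by \<open>r / 2\<close> along
  the outward normal leaves room for a ball on the far side. So the complement of a convex set fills
  a fixed proportion of every ball about a point outside the interior.\<close>

lemma exterior_ball:
  assumes y: "y \<notin> interior Q" and r: "0 < r"
  obtains c where "dist c y \<le> r / 2" "cball c (r / 4) \<inter> Q = {}"
proof -
  have "\<exists>a b. a \<noteq> 0 \<and> (\<forall>x\<in>interior Q. inner a x \<le> b) \<and> (\<forall>x\<in>{y}. b \<le> inner a x)"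
    using convex_Q interior_Q y by (intro separating_hyperplane_sets convex_interior) auto
  then obtain a b where a: "a \<noteq> 0" "\<And>x. x \<in> interior Q \<Longrightarrow> inner a x \<le> b" "b \<le> inner a y"
    by auto
  have "closure (interior Q) \<subseteq> {x. inner a x \<le> b}"
    using a(2) by (intro closure_minimal closed_halfspace_le) auto
  hence Q: "inner a x \<le> b" if "x \<in> Q" for x
    using that closed_Q convex_closure_interior[OF convex_Q interior_Q] by auto
  let ?c = "y + (r / 2) *\<^sub>R sgn a"
  show thesis
  proof
    show "dist ?c y \<le> r / 2"
      using r a(1) by (simp add: dist_norm norm_sgn)
    show "cball ?c (r / 4) \<inter> Q = {}"
    proof (intro equals0I)
      fix u assume "u \<in> cball ?c (r / 4) \<inter> Q"
      hence u: "norm (?c - u) \<le> r / 4" "inner a u \<le> b" using Q by (auto simp: dist_norm)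
      have "inner a (?c - u) \<le> norm a * (r / 4)"
        using norm_cauchy_schwarz[of a "?c - u"] u(1) by (meson mult_left_mono norm_ge_zero order_trans)
      moreover have "inner a (?c - u) = inner a y - inner a u + (r / 2) * norm a"
        using a(1) by (simp add: inner_diff_right inner_add_right sgn_div_norm dot_square_norm power2_eq_square)
      moreover have "norm a * (r / 4) < (r / 2) * norm a"
        using a(1) r by simp
      ultimately show False using u(2) a(3) by linarith
    qed
  qed
qed

text \<open>This is what allows the value 0 to be prescribed outside the square. On the exterior
  ball near \<open>y\<close> the field \<open>w\<close> is 0, so \<open>norm (w x)\<close> is itself
  an oscillation there and is bounded through the ball of radius \<open>2 * dist x y\<close> about
  \<open>x\<close>. The radii \<open>2 * dist x y\<close> and \<open>dist x y / 4\<close> have ratio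
  8.\<close>

lemma lipschitz_good_exterior:
  assumes x: "x \<in> good K" and y: "y \<notin> interior Q" and K: "0 \<le> K"
  shows "norm (w x) \<le> 2 * 8 ^ DIM('a) * K * dist x y"
proof (cases "x = y")
  case True
  hence "x \<in> frontier Q" using x y closed_Q by (auto simp: frontier_def good_def)
  thus ?thesis using vanish[of x] by (simp add: w_def True)
next
  case False
  let ?r = "dist x y"
  have r: "0 < ?r" using False by simp
  obtain c where c: "dist c y \<le> ?r / 2" "cball c (?r / 4) \<inter> Q = {}"
    using exterior_ball[OF y r] by blast
  have "dist c x \<le> dist c y + ?r" by metric
  hence "dist c x + ?r / 4 \<le> 2 * ?r" using c(1) r by linarith
  hence sub: "cball c (?r / 4) \<subseteq> cball x (2 * ?r)"
    by (simp add: cball_subset_cball_iff)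
  let ?F = "\<lambda>z. norm (w z - w x)"
  have "norm (w x) \<le> (2 * ?r * K) * 8 ^ DIM('a)"
  proof (rule le_of_average_le[where c = c and r = "?r / 4" and F = ?F])
    show "norm (w x) \<le> ?F z" if "z \<in> cball c (?r / 4)" for z
      using that c(2) by (auto simp: w_def disjoint_iff)
    have "(\<integral>\<^sup>+ z. ennreal (?F z) * indicator (cball c (?r / 4)) z \<partial>lborel) \<le>
      (\<integral>\<^sup>+ z. ennreal (?F z) * indicator (cball x (2 * ?r)) z \<partial>lborel)"
      using sub by (intro nn_integral_mono) (auto simp: indicator_def)
    also have "\<dots> \<le> ennreal (2 * ?r * K) * emeasure lborel (cball x (2 * ?r))"
      using r K x by (intro nn_integral_oscillation_le) auto
    also have "\<dots> = ennreal (2 * ?r * K) * emeasure lborel (cball c (8 * (?r / 4)))"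
      using r K by (simp add: emeasure_cball)
    finally show "(\<integral>\<^sup>+ z. ennreal (?F z) * indicator (cball c (?r / 4)) z \<partial>lborel) \<le>
        ennreal (2 * ?r * K) * emeasure lborel (cball c (8 * (?r / 4)))" .
  qed (use r K in auto)
  thus ?thesis by (simp add: mult_ac)
qed

text \<open>AM-GM in the form \<open>g \<le> (g\<^sup>2 / K + K) / 2\<close> reduces averages of \<open>g\<close> to averages of \<open>g\<^sup>2\<close>.\<close>
lemma bad_set_small:
  assumes int: "(\<integral>\<^sup>+ z. ennreal ((g z)\<^sup>2) * indicator Q z \<partial>lborel) \<le> ennreal C" and C: "0 \<le> C" and K: "0 < K"
  obtains E where "E \<in> sets borel" "emeasure lborel E \<le> ennreal (5 ^ DIM('a) * C / K\<^sup>2)" "Q - E \<subseteq> good K"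
proof -
  have [measurable]: "g \<in> borel_measurable borel" "Q \<in> sets borel"
    using cont_g closed_Q by (auto intro: borel_measurable_continuous_onI)
  let ?h = "\<lambda>z. ennreal ((g z)\<^sup>2) * indicator Q z"
  have "(\<integral>\<^sup>+ z. ?h z \<partial>lborel) < \<infinity>"
    using int by (auto simp: less_top[symmetric] top_unique)
  then obtain E where E: "E \<in> sets borel"
    "emeasure lborel E * ennreal (K\<^sup>2) \<le> 5 ^ DIM('a) * (\<integral>\<^sup>+ z. ?h z \<partial>lborel)"
    "\<And>x r. x \<notin> E \<Longrightarrow> 0 < r \<Longrightarrow>
       (\<integral>\<^sup>+ z. ?h z * indicator (cball x r) z \<partial>lborel) \<le> ennreal (K\<^sup>2) * emeasure lborel (cball x r)"
    \<comment> \<open>The inequality is applied to the square of \<open>g\<close> at level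
      \<open>K^2\<close>; applied to \<open>g\<close> at level \<open>K\<close> it would only give a
      set of measure O(1/K).\<close>
    using K by (elim maximal_function_weak_type[rotated, where c = "K\<^sup>2"]) auto
  show thesis
  proof
    show "E \<in> sets borel" by fact
    have "emeasure lborel E * ennreal (K\<^sup>2) \<le> 5 ^ DIM('a) * ennreal C"
      using E(2) int by (meson mult_left_mono order_trans zero_le)
    also have "\<dots> = ennreal (5 ^ DIM('a) * C / K\<^sup>2) * ennreal (K\<^sup>2)"
      using C K by (subst ennreal_mult[symmetric]) (auto simp: ennreal_mult simp flip: ennreal_power)
    finally show "emeasure lborel E \<le> ennreal (5 ^ DIM('a) * C / K\<^sup>2)"
      using K by (subst (asm) mult.commute, subst (asm) (2) mult.commute, subst (asm) ennreal_mult_le_mult_iff) auto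
    show "Q - E \<subseteq> good K"
    proof
      fix x assume x: "x \<in> Q - E"
      have "(\<integral>\<^sup>+ z. ennreal (g z) * indicator Q z * indicator (cball x r) z \<partial>lborel)
          \<le> ennreal K * emeasure lborel (cball x r)" if r: "0 < r" for r
      proof -
        have "(\<integral>\<^sup>+ z. ennreal (g z) * indicator Q z * indicator (cball x r) z \<partial>lborel) \<le>
          (\<integral>\<^sup>+ z. ennreal (1 / (2 * K)) * (?h z * indicator (cball x r) z) + ennreal (K / 2) * indicator (cball x r) z \<partial>lborel)"
        proof (intro nn_integral_mono)
          fix z
          have "0 \<le> (g z - K)\<^sup>2" by simp
          hence "2 * (K * g z) \<le> (g z)\<^sup>2 + K\<^sup>2" by (simp add: power2_diff algebra_simps)
          hence "g z \<le> 1 / (2 * K) * (g z)\<^sup>2 + K / 2"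
            using K by (simp add: field_simps power2_eq_square)
          hence "ennreal (g z) \<le> ennreal (1 / (2 * K)) * ennreal ((g z)\<^sup>2) + ennreal (K / 2)"
            using K by (simp flip: ennreal_mult ennreal_plus)
          thus "ennreal (g z) * indicator Q z * indicator (cball x r) z \<le>
             ennreal (1 / (2 * K)) * (?h z * indicator (cball x r) z) + ennreal (K / 2) * indicator (cball x r) z"
            by (auto simp: indicator_def)
        qed
        also have "\<dots> = ennreal (1 / (2 * K)) * (\<integral>\<^sup>+ z. ?h z * indicator (cball x r) z \<partial>lborel) + ennreal (K / 2) * emeasure lborel (cball x r)"
          by (simp add: nn_integral_add nn_integral_cmult)
        also have "\<dots> \<le> ennreal (1 / (2 * K)) * (ennreal (K\<^sup>2) * emeasure lborel (cball x r)) + ennreal (K / 2) * emeasure lborel (cball x r)"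
          using x r by (intro add_mono mult_left_mono E(3)) auto
        also have "\<dots> = ennreal K * emeasure lborel (cball x r)"
        proof -
          have "ennreal (1 / (2 * K)) * ennreal (K\<^sup>2) + ennreal (K / 2) = ennreal K"
            using K by (simp flip: ennreal_mult ennreal_plus add: power2_eq_square)
          thus ?thesis by (metis distrib_right mult.assoc)
        qed
        finally show ?thesis .
      qed
      thus "x \<in> good K" using x by (simp add: good_def)
    qed
  qed
qed

end

section \<open>Lipschitz perturbations of the identity\<close>

text \<open>McShane's extension: the lower envelope of the cones of slope \<open>L\<close> with
  vertices on the graph of \<open>f\<close>.\<close>

lemma lipschitz_extension_real:
  fixes f :: "'a::metric_space \<Rightarrow> real"
  assumes S: "S \<noteq> {}" and L: "0 \<le> L"
    and lip: "\<And>x y. x \<in> S \<Longrightarrow> y \<in> S \<Longrightarrow> \<bar>f x - f y\<bar> \<le> L * dist x y"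
  obtains F where "\<And>x. x \<in> S \<Longrightarrow> F x = f x" "\<And>x y. \<bar>F x - F y\<bar> \<le> L * dist x y"
proof
  define F where "F x = (INF s\<in>S. f s + L * dist x s)" for x
  have lower: "f s - L * dist x s \<le> f s' + L * dist x s'" if "s \<in> S" "s' \<in> S" for x s s'
  proof -
    have "f s - f s' \<le> L * dist s s'" using lip[OF that] by auto
    also have "\<dots> \<le> L * (dist x s + dist x s')"
      using L by (intro mult_left_mono) (metric, simp)
    finally show ?thesis by (simp add: algebra_simps)
  qed
  have bdd: "bdd_below ((\<lambda>s. f s + L * dist x s) ` S)" for x
    using S lower by (meson bdd_belowI2 ex_in_conv)
  show "F x = f x" if x: "x \<in> S" for x
  proof (rule antisym)
    show "F x \<le> f x"
      unfolding F_def using cINF_lower[OF bdd x, of x] by simp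
    show "f x \<le> F x"
      unfolding F_def using S lower[OF x, of _ x] by (intro cINF_greatest) auto
  qed
  have le: "F x \<le> F y + L * dist x y" for x y
  proof -
    have "F x - L * dist x y \<le> F y"
      unfolding F_def[of y]
    proof (rule cINF_greatest[OF S])
      fix s assume s: "s \<in> S"
      have "F x \<le> f s + L * dist x s"
        unfolding F_def by (rule cINF_lower[OF bdd s])
      also have "L * dist x s \<le> L * (dist x y + dist y s)"
        using L by (intro mult_left_mono) (metric, simp)
      finally show "F x - L * dist x y \<le> f s + L * dist y s" by (simp add: algebra_simps)
    qed
    thus ?thesis by simp
  qed
  show "\<bar>F x - F y\<bar> \<le> L * dist x y" for x y
    using le[of x y] le[of y x] by (simp add: dist_commute abs_le_iff)
qed

text \<open>McShane's extension in each coordinate; adding the two bounds gives the factor 2,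
  harmless because only the order of the constant in \<open>K\<close> matters.\<close>

lemma lipschitz_extension_prod:
  fixes f :: "'a::metric_space \<Rightarrow> real \<times> real"
  assumes S: "S \<noteq> {}" and L: "0 \<le> L"
    and lip: "\<And>x y. x \<in> S \<Longrightarrow> y \<in> S \<Longrightarrow> norm (f x - f y) \<le> L * dist x y"
  obtains F where "\<And>x. x \<in> S \<Longrightarrow> F x = f x" "\<And>x y. norm (F x - F y) \<le> 2 * L * dist x y"
proof -
  have fs: "\<bar>fst z\<bar> \<le> norm z" "\<bar>snd z\<bar> \<le> norm z" for z :: "real \<times> real"
    using norm_fst_le[of "fst z" "snd z"] norm_snd_le[of "snd z" "fst z"] by simp_all
  have 1: "\<bar>fst (f x) - fst (f y)\<bar> \<le> L * dist x y" if "x \<in> S" "y \<in> S" for x y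
    using order_trans[OF fs(1) lip[OF that]] by simp
  have 2: "\<bar>snd (f x) - snd (f y)\<bar> \<le> L * dist x y" if "x \<in> S" "y \<in> S" for x y
    using order_trans[OF fs(2) lip[OF that]] by simp
  obtain F1 where F1: "\<And>x. x \<in> S \<Longrightarrow> F1 x = fst (f x)" "\<And>x y. \<bar>F1 x - F1 y\<bar> \<le> L * dist x y"
    by (rule lipschitz_extension_real[OF S L, of "\<lambda>x. fst (f x)"]) (use 1 in auto)
  obtain F2 where F2: "\<And>x. x \<in> S \<Longrightarrow> F2 x = snd (f x)" "\<And>x y. \<bar>F2 x - F2 y\<bar> \<le> L * dist x y"
    by (rule lipschitz_extension_real[OF S L, of "\<lambda>x. snd (f x)"]) (use 2 in auto)
  show thesis
  proof
    show "(F1 x, F2 x) = f x" if "x \<in> S" for x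
      using that F1 F2 by simp
    fix x y
    have "norm ((F1 x, F2 x) - (F1 y, F2 y)) \<le> \<bar>F1 x - F1 y\<bar> + \<bar>F2 x - F2 y\<bar>"
      using norm_Pair_le[of "F1 x - F1 y" "F2 x - F2 y"] by simp
    also have "\<dots> \<le> 2 * L * dist x y"
      using F1(2)[of x y] F2(2)[of x y] by linarith
    finally show "norm ((F1 x, F2 x) - (F1 y, F2 y)) \<le> 2 * L * dist x y" .
  qed
qed

text \<open>The bound is assumed on the whole space, so that bijectivity follows from a contraction
  argument; the square is recovered afterwards from the set where \<open>u\<close> vanishes.\<close>

locale identity_perturbation =
  fixes u :: "'a::euclidean_space \<Rightarrow> 'a" and s :: real
  assumes lip: "\<And>x y. norm (u x - u y) \<le> s * dist x y" and s: "0 \<le> s" "s < 1"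
begin

definition \<phi> :: "'a \<Rightarrow> 'a" where "\<phi> x = x + u x"

lemma dist_le: "dist (\<phi> x) (\<phi> y) \<le> (1 + s) * dist x y"
proof -
  have "dist (\<phi> x) (\<phi> y) \<le> dist x y + norm (u x - u y)"
    unfolding \<phi>_def dist_norm by norm
  thus ?thesis using lip[of x y] by (simp add: algebra_simps)
qed

lemma dist_ge: "(1 - s) * dist x y \<le> dist (\<phi> x) (\<phi> y)"
proof -
  have "dist x y - norm (u x - u y) \<le> dist (\<phi> x) (\<phi> y)"
    unfolding \<phi>_def dist_norm by norm
  thus ?thesis using lip[of x y] by (simp add: algebra_simps)
qed

text \<open>Solving \<open>\<phi> x = p\<close> means finding a fixed point of the contraction that
  sends \<open>x\<close> to \<open>p - u x\<close>.\<close>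

lemma bij: "bij \<phi>"
proof (rule bijI)
  show "inj \<phi>"
  proof (rule injI)
    fix x y assume "\<phi> x = \<phi> y"
    hence "(1 - s) * dist x y \<le> 0" using dist_ge[of x y] by simp
    thus "x = y" using s by (simp add: mult_le_0_iff)
  qed
  show "surj \<phi>"
  proof (rule surjI)
    fix p
    have "\<exists>!x. p - u x = x"
      using s lip by (intro banach_fix_type[of s]) (auto simp: dist_norm norm_minus_commute)
    hence "\<exists>x. \<phi> x = p" by (auto simp: \<phi>_def algebra_simps)
    thus "\<phi> (SOME x. \<phi> x = p) = p" by (rule someI_ex)
  qed
qed

text \<open>The image is the preimage under the inverse map, which is Lipschitz and hence Borel
  measurable.\<close>

lemma image_borel:
  assumes "A \<in> sets borel"
  shows "\<phi> ` A \<in> sets borel"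
proof -
  let ?g = "inv \<phi>"
  have fg: "\<phi> (?g p) = p" for p
    using bij by (simp add: bij_is_surj surj_f_inv_f)
  have "(1 / (1 - s))-lipschitz_on UNIV ?g"
  proof (rule lipschitz_onI)
    show "dist (?g p) (?g q) \<le> 1 / (1 - s) * dist p q" for p q
      using dist_ge[of "?g p" "?g q"] s by (simp add: fg field_simps)
  qed (use s in auto)
  hence "?g \<in> borel_measurable borel"
    by (intro borel_measurable_continuous_onI lipschitz_on_continuous_on)
  hence "?g -` A \<in> sets borel"
    using assms by (metis inf_top.right_neutral measurable_sets space_borel)
  thus ?thesis
    using bij by (simp add: bij_vimage_eq_inv_image bij_imp_bij_inv inv_inv_eq)
qed

text \<open>Every point outside \<open>Q\<close> is fixed, so the complement of \<open>Q\<close> is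
  mapped onto itself, and a bijection of the whole space must then map \<open>Q\<close> onto
  \<open>Q\<close>.\<close>

lemma bij_betw_support:
  assumes "\<And>x. x \<notin> Q \<Longrightarrow> u x = 0"
  shows "bij_betw \<phi> Q Q"
proof -
  have "\<phi> ` (- Q) = - Q"
    using assms by (auto simp: \<phi>_def image_iff)
  hence "\<phi> ` Q = Q"
    using bij by (metis bij_image_Compl_eq double_compl)
  thus ?thesis using inj_on_subset[OF bij_is_inj[OF bij]] by (auto simp: bij_betw_def)
qed

end

section \<open>Cosine polynomials on the unit square\<close>

definition cosine :: "nat \<Rightarrow> real \<Rightarrow> real" where "cosine j x = cos (real j * pi * x)"
definition sine :: "nat \<Rightarrow> real \<Rightarrow> real" where "sine j x = sin (real j * pi * x)"

text \<open>One form for all sums that occur: the derivatives of the potential have a sine or a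
  cosine in each variable, the same index set, and the original coefficients times a
  multiplier.\<close>

definition tensor_sum ::
  "(nat \<Rightarrow> real \<Rightarrow> real) \<Rightarrow> (nat \<Rightarrow> real \<Rightarrow> real) \<Rightarrow> (nat \<times> nat) set \<Rightarrow> (nat \<times> nat \<Rightarrow> real) \<Rightarrow> real \<times> real \<Rightarrow> real"
  where "tensor_sum e f F a z = (\<Sum>i\<in>F. a i * (e (fst i) (fst z) * f (snd i) (snd z)))"

abbreviation "cos_sum \<equiv> tensor_sum cosine cosine"

text \<open>Subtraction on \<open>nat\<close> is truncated, so \<open>(j - k) + (k - j)\<close> is
  the distance of \<open>j\<close> and \<open>k\<close>. Frequencies thus stay natural numbers and
  cosine sums form an algebra.\<close>

lemma cosine_mult: "cosine j x * cosine k x = (cosine ((j - k) + (k - j)) x + cosine (j + k) x) / 2"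
proof -
  have "cos (real j * pi * x - real k * pi * x) = cos (real ((j - k) + (k - j)) * pi * x)"
  proof (cases "k \<le> j")
    case False
    have "cos (real j * pi * x - real k * pi * x) = cos (real k * pi * x - real j * pi * x)"
      by (metis cos_minus minus_diff_eq)
    thus ?thesis using False by (simp add: of_nat_diff algebra_simps)
  qed (simp add: of_nat_diff algebra_simps)
  thus ?thesis
    unfolding cosine_def cos_times_cos by (simp add: algebra_simps)
qed

definition is_cos_sum :: "(real \<times> real \<Rightarrow> real) \<Rightarrow> bool" where
  "is_cos_sum f \<longleftrightarrow> (\<exists>F a. finite F \<and> f = cos_sum F a)"

lemma is_cos_sum_basis: "is_cos_sum (\<lambda>z. c * (cosine j (fst z) * cosine k (snd z)))"
  unfolding is_cos_sum_def tensor_sum_def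
  by (rule exI[of _ "{(j,k)}"], rule exI[of _ "\<lambda>_. c"]) simp

lemma is_cos_sum_add:
  assumes "is_cos_sum f" "is_cos_sum g"
  shows "is_cos_sum (\<lambda>z. f z + g z)"
proof -
  obtain F a G b where F: "finite F" "f = cos_sum F a" and G: "finite G" "g = cos_sum G b"
    using assms by (auto simp: is_cos_sum_def)
  let ?a = "\<lambda>i. if i \<in> F then a i else 0" and ?b = "\<lambda>i. if i \<in> G then b i else 0"
  have "f z = cos_sum (F \<union> G) ?a z" "g z = cos_sum (F \<union> G) ?b z" for z
    unfolding F G tensor_sum_def using F(1) G(1)
    by (auto intro!: sum.mono_neutral_cong_left)
  hence "(\<lambda>z. f z + g z) = cos_sum (F \<union> G) (\<lambda>i. ?a i + ?b i)"
    by (auto simp: tensor_sum_def sum.distrib algebra_simps fun_eq_iff)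
  thus ?thesis using F(1) G(1) unfolding is_cos_sum_def by blast
qed

lemma is_cos_sum_const: "is_cos_sum (\<lambda>_. c)"
  using is_cos_sum_basis[of c 0 0] by (simp add: cosine_def)

lemma is_cos_sum_sum:
  assumes "finite F" "\<And>i. i \<in> F \<Longrightarrow> is_cos_sum (f i)"
  shows "is_cos_sum (\<lambda>z. \<Sum>i\<in>F. f i z)"
  using assms
proof (induction rule: finite_induct)
  case empty
  show ?case using is_cos_sum_const[of 0] by simp
next
  case (insert i F)
  have "is_cos_sum (\<lambda>z. f i z + (\<Sum>i\<in>F. f i z))"
    using insert by (intro is_cos_sum_add) auto
  thus ?case using insert by simp
qed

lemma is_cos_sum_mult:
  assumes "is_cos_sum f" "is_cos_sum g"
  shows "is_cos_sum (\<lambda>z. f z * g z)"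
proof -
  obtain F a G b where F: "finite F" "f = cos_sum F a" and G: "finite G" "g = cos_sum G b"
    using assms by (auto simp: is_cos_sum_def)
  have basis: "is_cos_sum (\<lambda>z. (a i * (cosine (fst i) (fst z) * cosine (snd i) (snd z))) *
      (b k * (cosine (fst k) (fst z) * cosine (snd k) (snd z))))" for i k
  proof -
    let ?c = "a i * b k / 4"
    let ?B = "\<lambda>m n z. ?c * (cosine m (fst z) * cosine n (snd z))"
    let ?d1 = "(fst i - fst k) + (fst k - fst i)" and ?d2 = "(snd i - snd k) + (snd k - snd i)"
    have "is_cos_sum (\<lambda>z. (?B ?d1 ?d2 z + ?B ?d1 (snd i + snd k) z) +
        (?B (fst i + fst k) ?d2 z + ?B (fst i + fst k) (snd i + snd k) z))"
      by (intro is_cos_sum_add is_cos_sum_basis)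
    also have "(\<lambda>z. (?B ?d1 ?d2 z + ?B ?d1 (snd i + snd k) z) +
        (?B (fst i + fst k) ?d2 z + ?B (fst i + fst k) (snd i + snd k) z)) =
        (\<lambda>z. (a i * (cosine (fst i) (fst z) * cosine (snd i) (snd z))) *
              (b k * (cosine (fst k) (fst z) * cosine (snd k) (snd z))))"
    proof
      fix z :: "real \<times> real"
      have prod: "c / 4 * (p * r) + c / 4 * (p * s) + (c / 4 * (q * r) + c / 4 * (q * s)) = c * (((p + q) / 2) * ((r + s) / 2))"
        for c p q r s :: real by (simp add: field_simps)
      have "(?B ?d1 ?d2 z + ?B ?d1 (snd i + snd k) z) +
        (?B (fst i + fst k) ?d2 z + ?B (fst i + fst k) (snd i + snd k) z) =
        (a i * b k) * ((cosine (fst i) (fst z) * cosine (fst k) (fst z)) * (cosine (snd i) (snd z) * cosine (snd k) (snd z)))"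
        unfolding prod cosine_mult ..
      thus "(?B ?d1 ?d2 z + ?B ?d1 (snd i + snd k) z) +
        (?B (fst i + fst k) ?d2 z + ?B (fst i + fst k) (snd i + snd k) z) =
        (a i * (cosine (fst i) (fst z) * cosine (snd i) (snd z))) *
              (b k * (cosine (fst k) (fst z) * cosine (snd k) (snd z)))"
        by (simp only: mult_ac)
    qed
    finally show ?thesis .
  qed
  have "is_cos_sum (\<lambda>z. \<Sum>i\<in>F. \<Sum>k\<in>G. (a i * (cosine (fst i) (fst z) * cosine (snd i) (snd z))) *
      (b k * (cosine (fst k) (fst z) * cosine (snd k) (snd z))))"
    using F(1) G(1) by (intro is_cos_sum_sum basis)
  thus ?thesis
    by (simp add: F(2) G(2) tensor_sum_def sum_product)
qed

section \<open>Density of cosine polynomials and approximation of indicators\<close>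

lemma continuous_on_cosine [continuous_intros]:
  fixes f :: "'a::t2_space \<Rightarrow> real"
  shows "continuous_on S f \<Longrightarrow> continuous_on S (\<lambda>x. cosine j (f x))"
  unfolding cosine_def by (intro continuous_intros)

lemma continuous_on_sine [continuous_intros]:
  fixes f :: "'a::t2_space \<Rightarrow> real"
  shows "continuous_on S f \<Longrightarrow> continuous_on S (\<lambda>x. sine j (f x))"
  unfolding sine_def by (intro continuous_intros)

lemma continuous_on_tensor_sum:
  assumes "\<And>j. continuous_on UNIV (e j)" "\<And>j. continuous_on UNIV (f j)"
  shows "continuous_on S (tensor_sum e f F a)"
  unfolding tensor_sum_def
  by (intro continuous_intros continuous_on_compose2[OF assms(1)] continuous_on_compose2[OF assms(2)]) auto

lemma unit_square_alt: "unit_square = {0..1} \<times> {0..1}"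
  by (simp add: unit_square_def cbox_Pair_eq)

lemma unit_square_borel [measurable, simp]: "unit_square \<in> sets borel"
  by (simp add: unit_square_def)

lemma measure_unit_square: "measure lborel unit_square = 1"
  by (simp add: unit_square_def content_Pair)

lemma emeasure_unit_square: "emeasure lborel unit_square = 1"
  unfolding unit_square_def by (subst emeasure_lborel_cbox) (auto simp: Basis_prod_def prod.union_disjoint)

lemma set_integrable_bounded:
  fixes f :: "'a::euclidean_space \<Rightarrow> real"
  assumes "f \<in> borel_measurable borel" "S \<in> sets borel" "bounded S" "\<And>z. z \<in> S \<Longrightarrow> \<bar>f z\<bar> \<le> B"
  shows "set_integrable lborel S f"
  unfolding set_integrable_def
  using assms emeasure_bounded_finite[OF assms(3)]
  by (intro integrableI_bounded_set_indicator[of _ _ _ B]) auto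

text \<open>Stone-Weierstrass for the algebra of cosine sums. Since the cosine is injective on
  [0, pi], \<open>cosine 1\<close> of one of the coordinates separates two given points.\<close>

lemma cos_sum_dense:
  assumes "continuous_on unit_square u" "0 < \<kappa>"
  obtains F a where "finite F" "\<And>z. z \<in> unit_square \<Longrightarrow> \<bar>u z - cos_sum F a z\<bar> < \<kappa>"
proof -
  have "\<exists>g. is_cos_sum g \<and> (\<forall>z\<in>unit_square. \<bar>u z - g z\<bar> < \<kappa>)"
  proof (rule Stone_Weierstrass_HOL)
    show "compact unit_square" by (simp add: unit_square_def)
    show "is_cos_sum f \<Longrightarrow> continuous_on unit_square f" for f
      by (auto simp: is_cos_sum_def intro!: continuous_on_tensor_sum continuous_intros)
    show "\<exists>f. is_cos_sum f \<and> f p \<noteq> f q" if pq: "p \<in> unit_square \<and> q \<in> unit_square \<and> p \<noteq> q" for p q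
    proof -
      have inj: "s = t" if "s \<in> {0..1}" "t \<in> {0..1}" "cosine 1 s = cosine 1 t" for s t
        using cos_inj_pi[of "pi * s" "pi * t"] that by (simp add: cosine_def mult_left_le)
      consider "fst p \<noteq> fst q" | "snd p \<noteq> snd q" using pq by (auto simp: prod_eq_iff)
      thus ?thesis
      proof cases
        case 1
        hence "cosine 1 (fst p) \<noteq> cosine 1 (fst q)" using inj pq by (auto simp: unit_square_alt)
        thus ?thesis
          by (intro exI[of _ "\<lambda>z. 1 * (cosine 1 (fst z) * cosine 0 (snd z))"] conjI is_cos_sum_basis) (auto simp: cosine_def)
      next
        case 2
        hence "cosine 1 (snd p) \<noteq> cosine 1 (snd q)" using inj pq by (auto simp: unit_square_alt)
        thus ?thesis
          by (intro exI[of _ "\<lambda>z. 1 * (cosine 0 (fst z) * cosine 1 (snd z))"] conjI is_cos_sum_basis) (auto simp: cosine_def)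
      qed
    qed
    show "is_cos_sum (\<lambda>_. c)" for c by (rule is_cos_sum_const)
    show "is_cos_sum (\<lambda>x. f x + g x)" if "is_cos_sum f \<and> is_cos_sum g" for f g
      using that by (blast intro: is_cos_sum_add)
    show "is_cos_sum (\<lambda>x. f x * g x)" if "is_cos_sum f \<and> is_cos_sum g" for f g
      using that by (blast intro: is_cos_sum_mult)
  qed fact+
  thus thesis using that by (auto simp: is_cos_sum_def)
qed

text \<open>By regularity a Urysohn function between a closed subset and an open superset of
  \<open>A\<close> differs from the indicator only on a small set, and it is then approximated
  uniformly. The bound 2, common to all \<open>A\<close>, later yields a common L^2 bound.\<close>

lemma cos_sum_approximates_indicator:
  assumes A: "A \<in> sets borel" "A \<subseteq> unit_square" and \<kappa>: "0 < \<kappa>" "\<kappa> \<le> 1"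
  obtains F a where "finite F" "\<And>z. z \<in> unit_square \<Longrightarrow> \<bar>cos_sum F a z\<bar> \<le> 2"
    "(LINT z:unit_square|lborel. \<bar>cos_sum F a z - indicator A z\<bar>) \<le> \<kappa>"
proof -
  have AL: "A \<in> sets lebesgue" using A by simp
  obtain U where U: "open U" "A \<subseteq> U" "emeasure lebesgue (U - A) < ennreal (\<kappa> / 4)"
    by (rule sets_lebesgue_outer_open[OF AL, of "\<kappa> / 4"]) (use \<kappa> in simp, blast)
  obtain C where C: "closed C" "C \<subseteq> A" "emeasure lebesgue (A - C) < ennreal (\<kappa> / 4)"
    by (rule sets_lebesgue_inner_closed[OF AL, of "\<kappa> / 4"]) (use \<kappa> in simp, blast)
  have [measurable]: "U \<in> sets borel" "C \<in> sets borel" "A \<in> sets borel"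
    using U C A by auto
  obtain u :: "real \<times> real \<Rightarrow> real" where u: "continuous_on UNIV u" "\<And>x. u x \<in> closed_segment 0 1"
    "\<And>x. x \<in> - U \<Longrightarrow> u x = 0" "\<And>x. x \<in> C \<Longrightarrow> u x = 1"
  proof (rule Urysohn[of "- U" C 0 "1 :: real"])
    show "closed (- U)" "closed C" "- U \<inter> C = {}" using U(1,2) C(1,2) by auto
  qed blast
  have u01: "0 \<le> u x" "u x \<le> 1" for x
    using u(2)[of x] by (auto simp: closed_segment_eq_real_ivl)
  obtain F a where F: "finite F" "\<And>z. z \<in> unit_square \<Longrightarrow> \<bar>u z - cos_sum F a z\<bar> < \<kappa> / 2"
    using cos_sum_dense[OF continuous_on_subset[OF u(1) subset_UNIV], of "\<kappa> / 2"] \<kappa> by (metis half_gt_zero)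
  have [measurable]: "cos_sum F a \<in> borel_measurable borel"
    by (intro borel_measurable_continuous_onI continuous_on_tensor_sum continuous_intros)
  show thesis
  proof
    show "finite F" by fact
    show bd: "\<bar>cos_sum F a z\<bar> \<le> 2" if "z \<in> unit_square" for z
      using F(2)[OF that] u01[of z] \<kappa> by linarith
    let ?B = "(U - A) \<union> (A - C)"
    have eB: "emeasure lborel ?B \<le> ennreal (\<kappa> / 2)"
    proof -
      have "emeasure lborel ?B \<le> emeasure lborel (U - A) + emeasure lborel (A - C)"
        by (rule emeasure_subadditive) auto
      also have "\<dots> \<le> ennreal (\<kappa> / 4) + ennreal (\<kappa> / 4)"
        using U C by (intro add_mono) auto
      also have "\<dots> = ennreal (\<kappa> / 2)"
        using \<kappa> by (subst ennreal_plus[symmetric]) auto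
      finally show ?thesis .
    qed
    have pw: "\<bar>cos_sum F a z - indicator A z\<bar> \<le> \<kappa> / 2 + indicator ?B z" if "z \<in> unit_square" for z
    proof -
      consider "z \<in> ?B" | "z \<notin> U" "z \<notin> A" "z \<notin> ?B" | "z \<in> C" "z \<in> A" "z \<notin> ?B"
        using U(2) C(2) by blast
      thus ?thesis
      proof cases
        case 1
        hence i: "indicator ?B z = (1::real)" by simp
        have "indicator A z = (0::real) \<or> indicator A z = (1::real)" by (simp add: indicator_def)
        thus ?thesis unfolding i using F(2)[OF that] u01[of z] by linarith
      next
        case 2
        thus ?thesis using F(2)[OF that] u(3)[of z] by simp
      next
        case 3
        thus ?thesis using F(2)[OF that] u(4)[of z] by (simp add: abs_minus_commute)
      qed
    qed
    have "(LINT z:unit_square|lborel. \<bar>cos_sum F a z - indicator A z\<bar>) \<le> (LINT z:unit_square|lborel. \<kappa> / 2 + indicator ?B z)"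
    proof (rule set_integral_mono)
      have "bounded unit_square" by (simp add: unit_square_def)
      show "set_integrable lborel unit_square (\<lambda>z. \<bar>cos_sum F a z - indicator A z\<bar>)"
      proof (rule set_integrable_bounded[where B = 3])
        show "\<bar>\<bar>cos_sum F a z - indicator A z\<bar>\<bar> \<le> 3" if "z \<in> unit_square" for z
          using bd[OF that] by (auto simp: indicator_def)
      qed (use \<open>bounded unit_square\<close> in auto)
      show "set_integrable lborel unit_square (\<lambda>z. \<kappa> / 2 + indicator ?B z)"
        using \<open>bounded unit_square\<close> \<kappa> by (intro set_integrable_bounded[where B = 2]) (auto simp: indicator_def)
    qed (rule pw)
    also have "\<dots> = \<kappa> / 2 + measure lborel (unit_square \<inter> ?B)"
    proof -
      have i: "set_integrable lborel unit_square (\<lambda>z. indicator ?B z :: real)" "set_integrable lborel unit_square (\<lambda>_. \<kappa> / 2)"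
        using \<kappa> by (auto simp: unit_square_def indicator_def intro!: set_integrable_bounded[where B = 1])
      have "(LINT z:unit_square|lborel. indicator ?B z) = measure lborel (unit_square \<inter> ?B)"
        by (simp add: set_lebesgue_integral_def indicator_inter_arith[symmetric])
      moreover have "(LINT z:unit_square|lborel. \<kappa> / 2) = \<kappa> / 2"
        by (simp add: set_lebesgue_integral_def measure_unit_square)
      ultimately show ?thesis by (subst set_integral_add(2)[OF i(2,1)]) simp
    qed
    also have "measure lborel (unit_square \<inter> ?B) \<le> \<kappa> / 2"
    proof -
      have "emeasure lborel (unit_square \<inter> ?B) \<le> ennreal (\<kappa> / 2)"
        by (rule order_trans[OF emeasure_mono eB]) auto
      thus ?thesis unfolding measure_def by (rule enn2real_leI[rotated]) (use \<kappa> in simp)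
    qed
    finally show "(LINT z:unit_square|lborel. \<bar>cos_sum F a z - indicator A z\<bar>) \<le> \<kappa>" by simp
  qed
qed

section \<open>Orthogonality, Parseval and Fourier multipliers\<close>

lemma integral_cos_int_pi:
  "((\<lambda>x. cos (of_int n * pi * x)) has_integral (if n = 0 then 1 else 0)) {0..1}"
proof (cases "n = 0")
  case True
  show ?thesis using has_integral_const_real[of "1::real" 0 1] True by simp
next
  case False
  have "((\<lambda>x. cos (of_int n * pi * x)) has_integral
      (sin (of_int n * pi * 1) / (of_int n * pi) - sin (of_int n * pi * 0) / (of_int n * pi))) {0..1}"
    using False
    by (intro fundamental_theorem_of_calculus)
      (auto intro!: derivative_eq_intros simp flip: has_real_derivative_iff_has_vector_derivative)
  thus ?thesis using False by (simp add: sin_int_times_real mult.commute[of _ pi])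
qed

text \<open>Squared L^2 norms on [0, 1]. As \<open>sine 0\<close> is the zero function,
  \<open>sin_norm\<close> never exceeds \<open>cos_norm\<close>, which lets sine sums be compared
  with cosine sums.\<close>

definition cos_norm :: "nat \<Rightarrow> real" where "cos_norm j = (if j = 0 then 1 else 1 / 2)"
definition sin_norm :: "nat \<Rightarrow> real" where "sin_norm j = (if j = 0 then 0 else 1 / 2)"

lemma cosine_orthogonal: "integral {0..1} (\<lambda>x. cosine j x * cosine k x) = (if j = k then cos_norm j else 0)"
proof -
  have eq: "cosine j x * cosine k x = (cos (of_int (int j - int k) * pi * x) + cos (of_int (int j + int k) * pi * x)) / 2" for x
    unfolding cosine_def cos_times_cos by (simp add: algebra_simps)
  have "((\<lambda>x. cosine j x * cosine k x) has_integral
     ((if int j - int k = 0 then 1 else 0) + (if int j + int k = 0 then 1 else 0)) / 2) {0..1}"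
    unfolding eq by (intro has_integral_divide has_integral_add integral_cos_int_pi)
  from integral_unique[OF this] show ?thesis by (auto simp: cos_norm_def)
qed

lemma sine_orthogonal: "integral {0..1} (\<lambda>x. sine j x * sine k x) = (if j = k then sin_norm j else 0)"
proof -
  have eq: "sine j x * sine k x = (cos (of_int (int j - int k) * pi * x) - cos (of_int (int j + int k) * pi * x)) / 2" for x
    unfolding sine_def sin_times_sin by (simp add: algebra_simps)
  have "((\<lambda>x. sine j x * sine k x) has_integral
     ((if int j - int k = 0 then 1 else 0) - (if int j + int k = 0 then 1 else 0)) / 2) {0..1}"
    unfolding eq by (intro has_integral_divide has_integral_diff integral_cos_int_pi)
  from integral_unique[OF this] show ?thesis by (auto simp: sin_norm_def)
qed

lemma integral_unit_square_product:
  fixes p q :: "real \<Rightarrow> real"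
  assumes p: "continuous_on UNIV p" and q: "continuous_on UNIV q"
  shows "integral unit_square (\<lambda>z. p (fst z) * q (snd z)) = integral {0..1} p * integral {0..1} q"
proof -
  have "continuous_on (cbox (0,0) (1,1)) (\<lambda>z. p (fst z) * q (snd z))"
    by (intro continuous_intros continuous_on_compose2[OF p] continuous_on_compose2[OF q]) auto
  from integral_prod_continuous[OF this] show ?thesis
    by (simp add: unit_square_def cbox_interval)
qed

lemma integrable_on_unit_square:
  fixes f :: "real \<times> real \<Rightarrow> real"
  assumes "continuous_on UNIV f"
  shows "f integrable_on unit_square"
  unfolding unit_square_def using continuous_on_subset[OF assms] by (intro integrable_continuous) auto

lemma tensor_sum_parseval:
  assumes F: "finite F" and e: "\<And>j. continuous_on UNIV (e j)" and f: "\<And>j. continuous_on UNIV (f j)"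
    and oe: "\<And>j k. integral {0..1} (\<lambda>x. e j x * e k x) = (if j = k then n j else 0)"
    and of: "\<And>j k. integral {0..1} (\<lambda>x. f j x * f k x) = (if j = k then m j else 0)"
  shows "integral unit_square (\<lambda>z. (tensor_sum e f F b z)\<^sup>2) = (\<Sum>i\<in>F. (b i)\<^sup>2 * (n (fst i) * m (snd i)))"
proof -
  let ?T = "\<lambda>i k z. (b i * b k) * ((e (fst i) (fst z) * e (fst k) (fst z)) * (f (snd i) (snd z) * f (snd k) (snd z)))"
  have cT: "continuous_on UNIV (?T i k)" for i k
    by (intro continuous_intros continuous_on_compose2[OF e] continuous_on_compose2[OF f]) auto
  have "(tensor_sum e f F b z)\<^sup>2 = (\<Sum>i\<in>F. \<Sum>k\<in>F. ?T i k z)" for z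
    unfolding tensor_sum_def power2_eq_square sum_product by (simp add: mult_ac)
  hence "integral unit_square (\<lambda>z. (tensor_sum e f F b z)\<^sup>2) = (\<Sum>i\<in>F. \<Sum>k\<in>F. integral unit_square (?T i k))"
    using F by (simp add: integral_sum integrable_sum integrable_on_unit_square[OF cT])
  also have "\<dots> = (\<Sum>i\<in>F. \<Sum>k\<in>F. if k = i then (b i)\<^sup>2 * (n (fst i) * m (snd i)) else 0)"
  proof (intro sum.cong refl)
    fix i k
    have "integral unit_square (?T i k) = (b i * b k) *
      (integral {0..1} (\<lambda>x. e (fst i) x * e (fst k) x) * integral {0..1} (\<lambda>x. f (snd i) x * f (snd k) x))"
      using e f integral_unit_square_product[of "\<lambda>x. e (fst i) x * e (fst k) x" "\<lambda>x. f (snd i) x * f (snd k) x"]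
      by (simp add: continuous_on_mult)
    thus "integral unit_square (?T i k) = (if k = i then (b i)\<^sup>2 * (n (fst i) * m (snd i)) else 0)"
      unfolding oe of by (cases "k = i") (auto simp: power2_eq_square, auto simp: prod_eq_iff)
  qed
  also have "\<dots> = (\<Sum>i\<in>F. (b i)\<^sup>2 * (n (fst i) * m (snd i)))"
    using F by (simp add: sum.delta)
  finally show ?thesis .
qed

lemma continuous_cosine: "continuous_on UNIV (cosine j)" and continuous_sine: "continuous_on UNIV (sine j)"
  using continuous_on_cosine[OF continuous_on_id, of UNIV j] continuous_on_sine[OF continuous_on_id, of UNIV j] by simp_all

text \<open>By Parseval the comparison is made mode by mode: neither the multiplier nor the exchange
  of a cosine for a sine increases the norm of a mode. The bound is independent of \<open>F\<close>,
  hence of the degree needed to approximate a given set.\<close>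

lemma multiplier_bound:
  assumes F: "finite F" and m: "\<And>i. \<bar>m i\<bar> \<le> 1"
    and e: "e = cosine \<or> e = sine" and f: "f = cosine \<or> f = sine"
  shows "integral unit_square (\<lambda>z. (tensor_sum e f F (\<lambda>i. a i * m i) z)\<^sup>2) \<le>
    integral unit_square (\<lambda>z. (cos_sum F a z)\<^sup>2)"
proof -
  define N where "N e = (if e = cosine then cos_norm else sin_norm)" for e
  have oe: "integral {0..1} (\<lambda>x. e j x * e k x) = (if j = k then N e j else 0)"
    if "e = cosine \<or> e = sine" for e j k
    using that cosine_orthogonal[of j k] sine_orthogonal[of j k] by (auto simp: N_def)
  have ce: "continuous_on UNIV (e j)" if "e = cosine \<or> e = sine" for e j
    using that continuous_cosine continuous_sine by auto
  have N: "0 \<le> N e j" "N e j \<le> cos_norm j" for e j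
    by (auto simp: N_def cos_norm_def sin_norm_def)
  have "integral unit_square (\<lambda>z. (tensor_sum e f F (\<lambda>i. a i * m i) z)\<^sup>2) =
     (\<Sum>i\<in>F. (a i * m i)\<^sup>2 * (N e (fst i) * N f (snd i)))"
    by (rule tensor_sum_parseval[OF F ce[OF e] ce[OF f] oe[OF e] oe[OF f]])
  also have "\<dots> \<le> (\<Sum>i\<in>F. (a i)\<^sup>2 * (cos_norm (fst i) * cos_norm (snd i)))"
  proof (intro sum_mono mult_mono N)
    fix i
    have "(m i)\<^sup>2 \<le> 1" using m[of i] by (simp add: abs_square_le_1)
    thus "(a i * m i)\<^sup>2 \<le> (a i)\<^sup>2" by (simp add: power_mult_distrib mult_left_le)
  qed (auto intro!: mult_nonneg_nonneg N order_trans[OF N(1) N(2)])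
  also have "\<dots> = integral unit_square (\<lambda>z. (cos_sum F a z)\<^sup>2)"
    by (rule tensor_sum_parseval[OF F continuous_cosine continuous_cosine cosine_orthogonal cosine_orthogonal, symmetric])
  finally show ?thesis .
qed

text \<open>Only the constant mode has nonzero mean. Dropping the index \<open>(0,0)\<close> is
  therefore the same as subtracting the mean, as the Neumann problem demands.\<close>

lemma integral_cos_sum:
  assumes F: "finite F"
  shows "integral unit_square (cos_sum F a) = (if (0,0) \<in> F then a (0,0) else 0)"
proof -
  have c0: "integral {0..1} (cosine j) = (if j = 0 then 1 else 0)" for j
    using integral_unique[OF integral_cos_int_pi[of "int j"]] by (simp add: cosine_def[abs_def])
  have c: "continuous_on UNIV (\<lambda>z. a i * (cosine (fst i) (fst z) * cosine (snd i) (snd z)))" for i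
    by (intro continuous_intros)
  have "integral unit_square (cos_sum F a) = (\<Sum>i\<in>F. a i * (integral {0..1} (cosine (fst i)) * integral {0..1} (cosine (snd i))))"
    unfolding tensor_sum_def[abs_def] using F
    by (simp add: integral_sum integrable_on_unit_square[OF c] integral_unit_square_product continuous_cosine)
  also have "\<dots> = (\<Sum>i\<in>F. if i = (0,0) then a (0,0) else 0)"
    by (intro sum.cong refl) (auto simp: c0 prod_eq_iff)
  also have "\<dots> = (if (0,0) \<in> F then a (0,0) else 0)"
    using F by (simp add: sum.delta)
  finally show ?thesis .
qed

section \<open>Fields with prescribed divergence\<close>

lemma has_derivative_tensor_sine_cosine:
  "(tensor_sum sine cosine F b has_derivative
    (\<lambda>(s,t). tensor_sum cosine cosine F (\<lambda>i. b i * (real (fst i) * pi)) z * s +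
            tensor_sum sine sine F (\<lambda>i. b i * - (real (snd i) * pi)) z * t)) (at z)"
proof -
  have "((\<lambda>z. \<Sum>i\<in>F. b i * (sine (fst i) (fst z) * cosine (snd i) (snd z))) has_derivative
    (\<lambda>h. \<Sum>i\<in>F. b i * (real (fst i) * pi) * (cosine (fst i) (fst z) * cosine (snd i) (snd z)) * fst h +
        b i * - (real (snd i) * pi) * (sine (fst i) (fst z) * sine (snd i) (snd z)) * snd h)) (at z)"
    unfolding sine_def cosine_def
    by (intro has_derivative_sum) (auto intro!: derivative_eq_intros simp: algebra_simps)
  thus ?thesis
    by (simp only: tensor_sum_def[abs_def] sum.distrib sum_distrib_right split_def)
qed

lemma has_derivative_tensor_cosine_sine:
  "(tensor_sum cosine sine F b has_derivative
    (\<lambda>(s,t). tensor_sum sine sine F (\<lambda>i. b i * - (real (fst i) * pi)) z * s +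
            tensor_sum cosine cosine F (\<lambda>i. b i * (real (snd i) * pi)) z * t)) (at z)"
proof -
  have "((\<lambda>z. \<Sum>i\<in>F. b i * (cosine (fst i) (fst z) * sine (snd i) (snd z))) has_derivative
    (\<lambda>h. \<Sum>i\<in>F. b i * - (real (fst i) * pi) * (sine (fst i) (fst z) * sine (snd i) (snd z)) * fst h +
        b i * (real (snd i) * pi) * (cosine (fst i) (fst z) * cosine (snd i) (snd z)) * snd h)) (at z)"
    unfolding sine_def cosine_def
    by (intro has_derivative_sum) (auto intro!: derivative_eq_intros simp: algebra_simps)
  thus ?thesis
    by (simp only: tensor_sum_def[abs_def] sum.distrib sum_distrib_right split_def)
qed

text \<open>A polynomial plateau: 0 at both ends of [0, 1], close to 1 in between, with layers of
  width of order \<open>1 / m\<close>. Being a polynomial it has an explicit derivative and explicit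
  integrals.\<close>

definition cutoff :: "nat \<Rightarrow> real \<Rightarrow> real" where "cutoff m y = 1 - (1 - 2 * y) ^ (2 * m)"
definition cutoff_deriv :: "nat \<Rightarrow> real \<Rightarrow> real" where "cutoff_deriv m y = 4 * real m * (1 - 2 * y) ^ (2 * m - 1)"

lemma has_derivative_cutoff: "(cutoff m has_real_derivative cutoff_deriv m y) (at y)"
  unfolding cutoff_def cutoff_deriv_def by (auto intro!: derivative_eq_intros)

lemma cutoff_bounds:
  assumes "0 \<le> y" "y \<le> 1"
  shows "0 \<le> cutoff m y" "cutoff m y \<le> 1" "\<bar>cutoff_deriv m y\<bar> \<le> 4 * real m"
proof -
  have "\<bar>1 - 2 * y\<bar> \<le> 1" using assms by auto
  hence p: "\<bar>1 - 2 * y\<bar> ^ k \<le> 1" for k by (intro power_le_one) auto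
  show "0 \<le> cutoff m y" using p[of "2 * m"] by (simp add: cutoff_def power_abs[symmetric] abs_le_iff)
  show "cutoff m y \<le> 1" by (simp add: cutoff_def)
  show "\<bar>cutoff_deriv m y\<bar> \<le> 4 * real m"
    using p[of "2 * m - 1"] by (simp add: cutoff_deriv_def abs_mult power_abs mult_left_le)
qed

lemma cutoff_endpoints: "cutoff m 0 = 0" "cutoff m 1 = 0"
  by (simp_all add: cutoff_def)

lemma continuous_cutoff: "continuous_on UNIV (cutoff m)" "continuous_on UNIV (cutoff_deriv m)"
  unfolding cutoff_def[abs_def] cutoff_deriv_def[abs_def] by (intro continuous_intros)+

lemma integral_cutoff: "integral {0..1} (\<lambda>y. (1 - cutoff m y)\<^sup>2) = 1 / (4 * real m + 1)"
proof -
  let ?k = "4 * m + 1"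
  let ?G = "\<lambda>y::real. - ((1 - 2 * y) ^ ?k) / (2 * real ?k)"
  have "((\<lambda>y. (1 - 2 * y) ^ (4 * m)) has_integral
     (?G 1 - ?G 0)) {0..1::real}"
  proof (rule fundamental_theorem_of_calculus)
    fix x :: real
    have "(?G has_real_derivative (1 - 2 * x) ^ (4 * m)) (at x within {0..1})"
    proof -
      have "((\<lambda>y. 1 - 2 * y) has_real_derivative - 2) (at x within {0..1})"
        by (auto intro!: derivative_eq_intros)
      from DERIV_cdivide[OF DERIV_minus[OF DERIV_power_Suc[OF this, of "4 * m"]], of "2 * real ?k"]
      show ?thesis by (rule DERIV_cong[THEN back_subst[of "\<lambda>f. (f has_real_derivative _) _"]]) (auto simp: field_simps)
    qed
    thus "(?G has_vector_derivative (1 - 2 * x) ^ (4 * m)) (at x within {0..1})"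
      by (simp add: has_real_derivative_iff_has_vector_derivative)
  qed simp
  moreover have "(1 - cutoff m y)\<^sup>2 = (1 - 2 * y) ^ (4 * m)" for y
    by (simp add: cutoff_def power_mult[symmetric] mult.commute flip: power_mult)
  ultimately have "integral {0..1} (\<lambda>y. (1 - cutoff m y)\<^sup>2) = 
     ?G 1 - ?G 0"
    by (simp add: integral_unique)
  also have "\<dots> = 1 / (4 * real m + 1)"
    by (simp add: field_simps)
  finally show ?thesis .
qed

lemma abs_mult_le_weighted: "\<bar>x * y\<bar> \<le> 1 / (2 * t) * x\<^sup>2 + t / 2 * y\<^sup>2" if "0 < t" for x y t :: real
proof -
  have "0 \<le> (\<bar>x\<bar> - t * \<bar>y\<bar>)\<^sup>2" by simp
  hence "2 * (t * \<bar>x * y\<bar>) \<le> x\<^sup>2 + t\<^sup>2 * y\<^sup>2"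
    by (simp add: power2_diff power_mult_distrib abs_mult mult_ac)
  thus ?thesis using that by (simp add: field_simps power2_eq_square)
qed

text \<open>Weighted AM-GM in the role of Cauchy-Schwarz: the square integral of
  \<open>1 - cutoff\<close> is \<open>1 / (4 * real m + 1)\<close> and that of \<open>u\<close> is
  at most 4, so both terms are of order \<open>t\<close>. Cutting off is cheap in L^1 although the
  slope of the cutoff is large.\<close>

lemma cutoff_error:
  assumes c: "continuous_on UNIV u" and u: "integral unit_square (\<lambda>z. (u z)\<^sup>2) \<le> 4" and t: "0 < t"
    and p: "p = fst \<or> p = snd" and m: "1 / (4 * real m + 1) \<le> 2 * t\<^sup>2"
  shows "integral unit_square (\<lambda>z. \<bar>(1 - cutoff m (p z)) * u z\<bar>) \<le> 3 * t"
proof -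
  have cp: "continuous_on UNIV (\<lambda>z. cutoff m (p z))"
    using p by (auto intro!: continuous_on_compose2[OF continuous_cutoff(1)] continuous_intros)
  have cc: "continuous_on UNIV (\<lambda>y. (1 - cutoff m y)\<^sup>2)"
    by (intro continuous_intros continuous_cutoff)
  have i1: "integral unit_square (\<lambda>z. (1 - cutoff m (p z))\<^sup>2) = 1 / (4 * real m + 1)"
    using p integral_unit_square_product[OF cc, of "\<lambda>_. 1"]
      integral_unit_square_product[OF _ cc, of "\<lambda>_. 1"] by (auto simp: integral_cutoff)
  have "integral unit_square (\<lambda>z. \<bar>(1 - cutoff m (p z)) * u z\<bar>) \<le>
    integral unit_square (\<lambda>z. (1 / (2 * t)) * (1 - cutoff m (p z))\<^sup>2 + (t / 2) * (u z)\<^sup>2)"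
    using abs_mult_le_weighted[OF t]
    by (intro integral_le integrable_on_unit_square continuous_intros c cp)
  also have "\<dots> = (1 / (2 * t)) * (1 / (4 * real m + 1)) + (t / 2) * integral unit_square (\<lambda>z. (u z)\<^sup>2)"
    using t by (subst integral_add) (auto intro!: integrable_on_unit_square continuous_intros c cp simp: i1)
  also have "\<dots> \<le> (1 / (2 * t)) * (2 * t\<^sup>2) + (t / 2) * 4"
    using m u t by (intro add_mono mult_left_mono) auto
  also have "\<dots> = 3 * t" using t by (simp add: power2_eq_square)
  finally show ?thesis .
qed

lemma frontier_unit_square:
  assumes "z \<in> frontier unit_square"
  shows "fst z = 0 \<or> fst z = 1 \<or> snd z = 0 \<or> snd z = 1"
  using assms by (cases z) (auto simp: unit_square_def frontier_cbox mem_box Basis_prod_def)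

text \<open>With \<open>w\<close> the Neumann solution of \<open>\<Delta>w = P - \<integral>P\<close>, the field is
  \<open>(cutoff y \<cdot> w\<^sub>x, cutoff x \<cdot> w\<^sub>y)\<close>. Since \<open>w\<^sub>x\<close> already vanishes for \<open>x \<in> {0, 1}\<close>, each component only
  has to be cut off in the other variable, so that no derivative of the cutoff enters the divergence.\<close>
lemma field_of_cos_sum:
  assumes F: "finite F" and bd: "\<And>z. z \<in> unit_square \<Longrightarrow> \<bar>cos_sum F a z\<bar> \<le> 2"
    and t: "0 < t" and m: "1 / (4 * real m + 1) \<le> 2 * t\<^sup>2"
  obtains v A11 A12 A21 A22 where
    "\<And>z. (v has_derivative (\<lambda>(s,t). (A11 z * s + A12 z * t, A21 z * s + A22 z * t))) (at z)"
    "continuous_on UNIV A11" "continuous_on UNIV A12" "continuous_on UNIV A21" "continuous_on UNIV A22"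
    "\<And>z. z \<in> frontier unit_square \<Longrightarrow> v z = 0"
    "integral unit_square (\<lambda>z. (A11 z)\<^sup>2 + (A12 z)\<^sup>2 + (A21 z)\<^sup>2 + (A22 z)\<^sup>2) \<le> 24 + 256 * (real m)\<^sup>2"
    "integral unit_square (\<lambda>z. \<bar>A11 z + A22 z - (cos_sum F a z - integral unit_square (cos_sum F a))\<bar>) \<le> 6 * t"
proof -
  define X Y :: "nat \<times> nat \<Rightarrow> real" where "X i = real (fst i) * pi" and "Y i = real (snd i) * pi" for i
  \<comment> \<open>\<open>q (0,0) = 0\<close> because of division by zero, so the constant mode is dropped.\<close>
  define q where "q i = 1 / ((X i)\<^sup>2 + (Y i)\<^sup>2)" for i
  \<comment> \<open>The potential has coefficients \<open>- a i * q i\<close> in the cosine basis.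
    \<open>U1\<close> and \<open>U2\<close> are its first partial derivatives, \<open>Uxx\<close>,
    \<open>Uyy\<close> and \<open>Uxy\<close> its second ones.\<close>
  define U1 where "U1 = tensor_sum sine cosine F (\<lambda>i. a i * (q i * X i))"
  define U2 where "U2 = tensor_sum cosine sine F (\<lambda>i. a i * (q i * Y i))"
  define Uxx where "Uxx = tensor_sum cosine cosine F (\<lambda>i. a i * (q i * X i * X i))"
  define Uyy where "Uyy = tensor_sum cosine cosine F (\<lambda>i. a i * (q i * Y i * Y i))"
  define Uxy where "Uxy = tensor_sum sine sine F (\<lambda>i. a i * (q i * X i * - Y i))"
  have dU1: "(U1 has_derivative (\<lambda>(s,t). Uxx z * s + Uxy z * t)) (at z)" for z
    using has_derivative_tensor_sine_cosine[of F "\<lambda>i. a i * (q i * X i)" z]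
    unfolding U1_def Uxx_def Uxy_def X_def Y_def by (simp add: mult.assoc)
  have dU2: "(U2 has_derivative (\<lambda>(s,t). Uxy z * s + Uyy z * t)) (at z)" for z
    using has_derivative_tensor_cosine_sine[of F "\<lambda>i. a i * (q i * Y i)" z]
    unfolding U2_def Uyy_def Uxy_def X_def Y_def by (simp add: mult_ac)
  have cU: "continuous_on UNIV U1" "continuous_on UNIV U2" "continuous_on UNIV Uxx" "continuous_on UNIV Uyy" "continuous_on UNIV Uxy"
    unfolding U1_def U2_def Uxx_def Uyy_def Uxy_def
    by (intro continuous_on_tensor_sum continuous_cosine continuous_sine)+
  have cP: "continuous_on UNIV (cos_sum F a)"
    by (intro continuous_on_tensor_sum continuous_cosine)
  have P4: "integral unit_square (\<lambda>z. (cos_sum F a z)\<^sup>2) \<le> 4"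
  proof -
    have "integral unit_square (\<lambda>z. (cos_sum F a z)\<^sup>2) \<le> integral unit_square (\<lambda>_. 4)"
    proof (intro integral_le integrable_on_unit_square continuous_intros cP)
      fix z assume "z \<in> unit_square"
      hence "\<bar>cos_sum F a z\<bar>\<^sup>2 \<le> 2\<^sup>2" by (intro power_mono bd) auto
      thus "(cos_sum F a z)\<^sup>2 \<le> 4" by simp
    qed
    thus ?thesis using measure_unit_square by (simp add: unit_square_def)
  qed
  \<comment> \<open>A nonzero frequency is at least pi. Because of this gap, the multipliers of the
    first derivatives are bounded by 1 just like those of the second ones.\<close>
  have X1: "X i = 0 \<or> 1 \<le> X i" "Y i = 0 \<or> 1 \<le> Y i" "0 \<le> X i" "0 \<le> Y i" for i
  proof -
    have "1 \<le> real k * pi" if "k \<noteq> 0" for k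
      using mult_mono[of 1 "real k" 1 pi] that pi_ge_two by simp
    thus "X i = 0 \<or> 1 \<le> X i" "Y i = 0 \<or> 1 \<le> Y i"
      unfolding X_def Y_def by (metis mult_zero_left of_nat_0)+
  qed (auto simp: X_def Y_def)
  have mult: "\<bar>q i * X i\<bar> \<le> 1" "\<bar>q i * Y i\<bar> \<le> 1" "\<bar>q i * X i * X i\<bar> \<le> 1" "\<bar>q i * Y i * Y i\<bar> \<le> 1"
    "\<bar>q i * X i * - Y i\<bar> \<le> 1" for i
  proof -
    define S where "S = (X i)\<^sup>2 + (Y i)\<^sup>2"
    have S: "0 \<le> S" by (simp add: S_def)
    have le: "\<bar>q i * r\<bar> \<le> 1" if "\<bar>r\<bar> \<le> S" for r
      using that S by (cases "S = 0") (auto simp: q_def S_def[symmetric] abs_mult divide_le_eq_1)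
    have sq: "r \<le> r\<^sup>2" if "r = 0 \<or> 1 \<le> r" for r :: real
      using that by (auto simp: power2_eq_square)
    have "X i \<le> S" "Y i \<le> S"
      using sq[OF X1(1), of i] sq[OF X1(2), of i] unfolding S_def by (smt (verit) zero_le_power2)+
    thus "\<bar>q i * X i\<bar> \<le> 1" "\<bar>q i * Y i\<bar> \<le> 1"
      using X1(3,4)[of i] by (auto intro!: le)
    show "\<bar>q i * X i * X i\<bar> \<le> 1" "\<bar>q i * Y i * Y i\<bar> \<le> 1"
      using le[of "X i * X i"] le[of "Y i * Y i"] by (auto simp: S_def power2_eq_square mult.assoc)
    have "0 \<le> (X i - Y i)\<^sup>2" by simp
    hence "X i * Y i \<le> S"
      using X1(3,4)[of i] mult_nonneg_nonneg[OF X1(3,4), of i i] unfolding S_def power2_diff by linarith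
    thus "\<bar>q i * X i * - Y i\<bar> \<le> 1"
      using le[of "- (X i * Y i)"] mult_nonneg_nonneg[OF X1(3,4), of i i] by (simp add: mult.assoc)
  qed
  have n: "integral unit_square (\<lambda>z. (U1 z)\<^sup>2) \<le> 4" "integral unit_square (\<lambda>z. (U2 z)\<^sup>2) \<le> 4"
    "integral unit_square (\<lambda>z. (Uxx z)\<^sup>2) \<le> 4" "integral unit_square (\<lambda>z. (Uyy z)\<^sup>2) \<le> 4"
    "integral unit_square (\<lambda>z. (Uxy z)\<^sup>2) \<le> 4"
    unfolding U1_def U2_def Uxx_def Uyy_def Uxy_def
    by (rule order_trans[OF multiplier_bound[OF F] P4]; (rule mult)?; simp)+
  have lap: "Uxx z + Uyy z = cos_sum F a z - integral unit_square (cos_sum F a)" for z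
  proof -
    have one: "q i * X i * X i + q i * Y i * Y i = (if i = (0,0) then 0 else 1)" for i
    proof (cases "i = (0,0)")
      case False
      hence "X i \<noteq> 0 \<or> Y i \<noteq> 0" by (auto simp: X_def Y_def prod_eq_iff)
      hence "(X i)\<^sup>2 + (Y i)\<^sup>2 \<noteq> 0" by (simp add: sum_power2_eq_zero_iff)
      thus ?thesis using False by (simp add: q_def power2_eq_square add_divide_distrib[symmetric])
    qed (simp add: X_def Y_def)
    let ?e = "\<lambda>i. cosine (fst i) (fst z) * cosine (snd i) (snd z)"
    have "Uxx z + Uyy z = (\<Sum>i\<in>F. (a i * (q i * X i * X i + q i * Y i * Y i)) * ?e i)"
      unfolding Uxx_def Uyy_def tensor_sum_def by (simp add: sum.distrib[symmetric] algebra_simps)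
    also have "\<dots> = (\<Sum>i\<in>F. a i * ?e i - (if i = (0,0) then a (0,0) else 0))"
      unfolding one by (intro sum.cong refl) (auto simp: cosine_def)
    also have "\<dots> = cos_sum F a z - (if (0,0) \<in> F then a (0,0) else 0)"
      using F by (simp add: sum_subtractf tensor_sum_def sum.delta)
    finally show ?thesis by (simp add: integral_cos_sum[OF F])
  qed
  define v where "v z = (cutoff m (snd z) * U1 z, cutoff m (fst z) * U2 z)" for z
  define A11 where "A11 z = cutoff m (snd z) * Uxx z" for z
  define A12 where "A12 z = cutoff_deriv m (snd z) * U1 z + cutoff m (snd z) * Uxy z" for z
  define A21 where "A21 z = cutoff_deriv m (fst z) * U2 z + cutoff m (fst z) * Uxy z" for z
  define A22 where "A22 z = cutoff m (fst z) * Uyy z" for z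
  have cc: "continuous_on UNIV (\<lambda>z. cutoff m (fst z))" "continuous_on UNIV (\<lambda>z. cutoff m (snd z))"
     "continuous_on UNIV (\<lambda>z. cutoff_deriv m (fst z))" "continuous_on UNIV (\<lambda>z. cutoff_deriv m (snd z))"
    by (intro continuous_on_compose2[OF continuous_cutoff(1)] continuous_on_compose2[OF continuous_cutoff(2)] continuous_intros; simp)+
  have cA: "continuous_on UNIV A11" "continuous_on UNIV A12" "continuous_on UNIV A21" "continuous_on UNIV A22"
    unfolding A11_def[abs_def] A12_def[abs_def] A21_def[abs_def] A22_def[abs_def]
    by (intro continuous_intros cU cc)+
  show thesis
  proof
    show "(v has_derivative (\<lambda>(s,t). (A11 z * s + A12 z * t, A21 z * s + A22 z * t))) (at z)" for z
    proof -
      have "((\<lambda>z. cutoff m (snd z)) has_derivative (\<lambda>h. cutoff_deriv m (snd z) * snd h)) (at z)"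
        by (rule has_derivative_compose[OF has_derivative_snd[OF has_derivative_ident]
            has_derivative_cutoff[unfolded has_field_derivative_def]])
      moreover have "((\<lambda>z. cutoff m (fst z)) has_derivative (\<lambda>h. cutoff_deriv m (fst z) * fst h)) (at z)"
        by (rule has_derivative_compose[OF has_derivative_fst[OF has_derivative_ident]
            has_derivative_cutoff[unfolded has_field_derivative_def]])
      ultimately have "(v has_derivative (\<lambda>h.
         (cutoff m (snd z) * (case h of (s,t) \<Rightarrow> Uxx z * s + Uxy z * t) + cutoff_deriv m (snd z) * snd h * U1 z,
          cutoff m (fst z) * (case h of (s,t) \<Rightarrow> Uxy z * s + Uyy z * t) + cutoff_deriv m (fst z) * fst h * U2 z))) (at z)"
        unfolding v_def[abs_def] by (intro has_derivative_Pair has_derivative_mult dU1 dU2)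
      thus ?thesis
        by (rule has_derivative_eq_rhs) (auto simp: fun_eq_iff A11_def A12_def A21_def A22_def algebra_simps)
    qed
    show "v z = 0" if "z \<in> frontier unit_square" for z
    proof -
      have s: "sine j 0 = 0" "sine j 1 = 0" for j by (simp_all add: sine_def)
      show ?thesis
        using frontier_unit_square[OF that] cutoff_endpoints[of m]
        by (auto simp: v_def U1_def U2_def tensor_sum_def s zero_prod_def)
    qed
    show "integral unit_square (\<lambda>z. (A11 z)\<^sup>2 + (A12 z)\<^sup>2 + (A21 z)\<^sup>2 + (A22 z)\<^sup>2) \<le> 24 + 256 * (real m)\<^sup>2"
    proof -
      let ?M = "32 * (real m)\<^sup>2"
      have prod: "(p * u)\<^sup>2 \<le> u\<^sup>2" if "0 \<le> p" "p \<le> 1" for p u :: real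
        using that by (simp add: power_mult_distrib mult_left_le_one_le power_le_one)
      have mix: "(d * u + p * w)\<^sup>2 \<le> ?M * u\<^sup>2 + 2 * w\<^sup>2" if "\<bar>d\<bar> \<le> 4 * real m" "0 \<le> p" "p \<le> 1" for d p u w :: real
      proof -
        have "(d * u + p * w)\<^sup>2 \<le> 2 * (d * u)\<^sup>2 + 2 * (p * w)\<^sup>2"
          using zero_le_power2[of "d * u - p * w"] by (simp add: power2_eq_square algebra_simps)
        moreover have "(d * u)\<^sup>2 \<le> 16 * (real m)\<^sup>2 * u\<^sup>2"
        proof -
          have "\<bar>d\<bar>\<^sup>2 \<le> (4 * real m)\<^sup>2" using that by (intro power_mono) auto
          thus ?thesis by (simp add: power_mult_distrib mult_right_mono)
        qed
        ultimately show ?thesis using prod[OF that(2,3), of w] by linarith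
      qed
      \<comment> \<open>After this pointwise bound six integrals remain, each at most 4. The slope
        \<open>4 * real m\<close> of the cutoff enters squared, so the result depends on
        \<open>m\<close> alone.\<close>
      have "integral unit_square (\<lambda>z. (A11 z)\<^sup>2 + (A12 z)\<^sup>2 + (A21 z)\<^sup>2 + (A22 z)\<^sup>2) \<le>
        integral unit_square (\<lambda>z. (Uxx z)\<^sup>2 + (?M * (U1 z)\<^sup>2 + 2 * (Uxy z)\<^sup>2) + (?M * (U2 z)\<^sup>2 + 2 * (Uxy z)\<^sup>2) + (Uyy z)\<^sup>2)"
      proof (intro integral_le integrable_on_unit_square continuous_intros cA cU)
        fix z assume "z \<in> unit_square"
        hence z: "0 \<le> fst z" "fst z \<le> 1" "0 \<le> snd z" "snd z \<le> 1" by (auto simp: unit_square_alt)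
        show "(A11 z)\<^sup>2 + (A12 z)\<^sup>2 + (A21 z)\<^sup>2 + (A22 z)\<^sup>2 \<le>
           (Uxx z)\<^sup>2 + (?M * (U1 z)\<^sup>2 + 2 * (Uxy z)\<^sup>2) + (?M * (U2 z)\<^sup>2 + 2 * (Uxy z)\<^sup>2) + (Uyy z)\<^sup>2"
          unfolding A11_def A12_def A21_def A22_def
          by (intro add_mono prod mix cutoff_bounds z)
      qed
      also have "\<dots> = integral unit_square (\<lambda>z. (Uxx z)\<^sup>2) +
         (?M * integral unit_square (\<lambda>z. (U1 z)\<^sup>2) + 2 * integral unit_square (\<lambda>z. (Uxy z)\<^sup>2)) +
         (?M * integral unit_square (\<lambda>z. (U2 z)\<^sup>2) + 2 * integral unit_square (\<lambda>z. (Uxy z)\<^sup>2)) +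
         integral unit_square (\<lambda>z. (Uyy z)\<^sup>2)"
      proof -
        have sqi: "(\<lambda>z. (u z)\<^sup>2) integrable_on unit_square" if "continuous_on UNIV u" for u :: "real \<times> real \<Rightarrow> real"
          by (intro integrable_on_unit_square continuous_intros that)
        show ?thesis
          by (intro integral_unique has_integral_add has_integral_mult_right integrable_integral sqi cU)
      qed
      also have "\<dots> \<le> 4 + (?M * 4 + 2 * 4) + (?M * 4 + 2 * 4) + 4"
        by (intro add_mono mult_left_mono n) auto
      finally show ?thesis by simp
    qed
    show "integral unit_square (\<lambda>z. \<bar>A11 z + A22 z - (cos_sum F a z - integral unit_square (cos_sum F a))\<bar>) \<le> 6 * t"
    proof -
      \<comment> \<open>\<open>Uxx + Uyy\<close> is exactly the polynomial minus its mean, so the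
        error consists of what the two cutoffs remove.\<close>
      have "integral unit_square (\<lambda>z. \<bar>A11 z + A22 z - (cos_sum F a z - integral unit_square (cos_sum F a))\<bar>) \<le>
        integral unit_square (\<lambda>z. \<bar>(1 - cutoff m (snd z)) * Uxx z\<bar> + \<bar>(1 - cutoff m (fst z)) * Uyy z\<bar>)"
      proof (intro integral_le integrable_on_unit_square continuous_intros cA cU cP cc)
        fix z
        have "A11 z + A22 z - (cos_sum F a z - integral unit_square (cos_sum F a)) =
          - ((1 - cutoff m (snd z)) * Uxx z + (1 - cutoff m (fst z)) * Uyy z)"
          unfolding lap[symmetric] A11_def A22_def by (simp add: algebra_simps)
        thus "\<bar>A11 z + A22 z - (cos_sum F a z - integral unit_square (cos_sum F a))\<bar> \<le>
          \<bar>(1 - cutoff m (snd z)) * Uxx z\<bar> + \<bar>(1 - cutoff m (fst z)) * Uyy z\<bar>"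
          by simp
      qed
      also have "\<dots> = integral unit_square (\<lambda>z. \<bar>(1 - cutoff m (snd z)) * Uxx z\<bar>) +
          integral unit_square (\<lambda>z. \<bar>(1 - cutoff m (fst z)) * Uyy z\<bar>)"
        by (intro integral_add integrable_on_unit_square continuous_intros cU cc)
      also have "\<dots> \<le> 3 * t + 3 * t"
        by (intro add_mono cutoff_error cU n t m) auto
      finally show ?thesis by simp
    qed
  qed (rule cA)+
qed

section \<open>Uniform fields for arbitrary Borel sets\<close>

lemma set_integrable_unit_square:
  fixes f :: "real \<times> real \<Rightarrow> real"
  assumes "continuous_on UNIV f"
  shows "set_integrable lborel unit_square f"
  unfolding set_integrable_def unit_square_def
  using continuous_on_subset[OF assms] by (intro borel_integrable_compact) auto

lemma set_integrable_indicator_unit_square: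
  assumes "A \<in> sets borel"
  shows "set_integrable lborel unit_square (indicator A :: _ \<Rightarrow> real)"
  using assms by (intro set_integrable_bounded[where B = 1]) (auto simp: unit_square_def indicator_def)

lemma set_integral_indicator_unit_square:
  assumes "A \<in> sets borel" "A \<subseteq> unit_square"
  shows "(LINT z:unit_square|lborel. indicator A z :: real) = measure lborel A"
proof -
  have "(LINT z:unit_square|lborel. indicator A z :: real) = measure lborel (unit_square \<inter> A)"
    by (simp add: set_lebesgue_integral_def indicator_inter_arith[symmetric])
  thus ?thesis using assms(2) by (simp add: Int_absorb1)
qed

lemma set_integral_const_unit_square: "(LINT z:unit_square|lborel. (c::real)) = c"
  by (simp add: set_lebesgue_integral_def measure_unit_square)

text \<open>\<open>C\<close> is chosen before \<open>A\<close>: it depends on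
  \<open>\<kappa>\<close> only, through the exponent \<open>m\<close> of the cutoff. This is the
  source of the uniformity in the theorem.\<close>

lemma approximate_divergence_field:
  assumes \<kappa>: "0 < \<kappa>"
  shows "\<exists>C\<ge>0. \<forall>A. A \<in> sets borel \<longrightarrow> A \<subseteq> unit_square \<longrightarrow>
    (\<exists>v A11 A12 A21 A22.
      (\<forall>z. (v has_derivative (\<lambda>(s,t). (A11 z * s + A12 z * t, A21 z * s + A22 z * t))) (at z)) \<and>
      continuous_on UNIV A11 \<and> continuous_on UNIV A12 \<and> continuous_on UNIV A21 \<and> continuous_on UNIV A22 \<and>
      (\<forall>z\<in>frontier unit_square. v z = 0) \<and>
      integral unit_square (\<lambda>z. (A11 z)\<^sup>2 + (A12 z)\<^sup>2 + (A21 z)\<^sup>2 + (A22 z)\<^sup>2) \<le> C \<and>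
      (LINT z:unit_square|lborel. \<bar>A11 z + A22 z - (indicator A z - measure lborel A)\<bar>) \<le> \<kappa>)"
proof -
  \<comment> \<open>Half of \<open>\<kappa>\<close> is reserved for the cutoff error
    \<open>6 * t\<close>. The other half is shared by two errors of at most \<open>k\<close>:
    replacing the polynomial by the indicator, and its mean by the area of \<open>A\<close>.\<close>
  define t where "t = \<kappa> / 12"
  have t: "0 < t" using \<kappa> by (simp add: t_def)
  define k where "k = min 1 (\<kappa> / 4)"
  have k: "0 < k" "k \<le> 1" "k \<le> \<kappa> / 4" using \<kappa> by (auto simp: k_def)
  obtain m :: nat where m0: "1 / (2 * t\<^sup>2) < real m" using reals_Archimedean2 by blast
  have m: "1 / (4 * real m + 1) \<le> 2 * t\<^sup>2"
  proof -
    have "1 < real m * (2 * t\<^sup>2)" using m0 t by (simp add: field_simps)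
    also have "\<dots> \<le> (4 * real m + 1) * (2 * t\<^sup>2)" by (intro mult_right_mono) auto
    finally show ?thesis by (simp add: field_simps)
  qed
  show ?thesis
  proof (intro exI[of _ "24 + 256 * (real m)\<^sup>2"] conjI allI impI)
    fix A assume A: "A \<in> sets borel" "A \<subseteq> unit_square"
    obtain F a where F: "finite F" "\<And>z. z \<in> unit_square \<Longrightarrow> \<bar>cos_sum F a z\<bar> \<le> 2"
      "(LINT z:unit_square|lborel. \<bar>cos_sum F a z - indicator A z\<bar>) \<le> k"
      using cos_sum_approximates_indicator[OF A k(1,2)] by blast
    let ?P = "cos_sum F a" and ?\<alpha> = "measure lborel A"
    let ?p = "integral unit_square ?P"
    obtain v A11 A12 A21 A22 where v:
      "\<And>z. (v has_derivative (\<lambda>(s,t). (A11 z * s + A12 z * t, A21 z * s + A22 z * t))) (at z)"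
      and c: "continuous_on UNIV A11" "continuous_on UNIV A12" "continuous_on UNIV A21" "continuous_on UNIV A22"
      and v0: "\<And>z. z \<in> frontier unit_square \<Longrightarrow> v z = 0"
      and l2: "integral unit_square (\<lambda>z. (A11 z)\<^sup>2 + (A12 z)\<^sup>2 + (A21 z)\<^sup>2 + (A22 z)\<^sup>2) \<le> 24 + 256 * (real m)\<^sup>2"
      and div: "integral unit_square (\<lambda>z. \<bar>A11 z + A22 z - (?P z - ?p)\<bar>) \<le> 6 * t"
      using field_of_cos_sum[OF F(1,2) t m] by blast
    have cP: "continuous_on UNIV ?P" by (intro continuous_on_tensor_sum continuous_cosine)
    note iA = set_integrable_indicator_unit_square[OF A(1)]
    note iP = set_integrable_unit_square[OF cP]
    have cD: "continuous_on UNIV (\<lambda>z. \<bar>A11 z + A22 z - (?P z - ?p)\<bar>)" by (intro continuous_intros c cP)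
    note iD = set_integrable_unit_square[OF cD]
    have iPA: "set_integrable lborel unit_square (\<lambda>z. ?P z - indicator A z)"
      by (rule set_integral_diff(1)[OF iP iA])
    have "?p - ?\<alpha> = (LINT z:unit_square|lborel. ?P z - indicator A z)"
      using set_integral_diff(2)[OF iP iA] set_borel_integral_eq_integral(2)[OF iP]
        set_integral_indicator_unit_square[OF A] by simp
    hence p: "\<bar>?p - ?\<alpha>\<bar> \<le> k"
      using F(3) set_integral_norm_bound[OF iPA] by simp
    have ic: "set_integrable lborel unit_square (\<lambda>_. \<bar>?p - ?\<alpha>\<bar>)"
      by (intro set_integrable_unit_square continuous_intros)
    have "set_integrable lborel unit_square (\<lambda>z. \<bar>A11 z + A22 z - (indicator A z - ?\<alpha>)\<bar>)"
      by (intro set_integrable_abs set_integral_diff(1) iA set_integrable_unit_square continuous_intros c)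
    hence "(LINT z:unit_square|lborel. \<bar>A11 z + A22 z - (indicator A z - ?\<alpha>)\<bar>) \<le>
      (LINT z:unit_square|lborel. \<bar>A11 z + A22 z - (?P z - ?p)\<bar> + (\<bar>?P z - indicator A z\<bar> + \<bar>?p - ?\<alpha>\<bar>))"
      by (rule set_integral_mono) (intro set_integral_add(1) iD set_integrable_abs[OF iPA] ic, linarith)
    also have "\<dots> = (LINT z:unit_square|lborel. \<bar>A11 z + A22 z - (?P z - ?p)\<bar>) +
        ((LINT z:unit_square|lborel. \<bar>?P z - indicator A z\<bar>) + \<bar>?p - ?\<alpha>\<bar>)"
      by (simp add: set_integral_add iD set_integrable_abs[OF iPA] ic set_integral_const_unit_square)
    also have "\<dots> \<le> 6 * t + (k + k)"
      using div F(3) p set_borel_integral_eq_integral(2)[OF iD] by (intro add_mono) simp_all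
    also have "\<dots> \<le> \<kappa>" using k(3) by (simp add: t_def)
    finally show "\<exists>v A11 A12 A21 A22.
      (\<forall>z. (v has_derivative (\<lambda>(s,t). (A11 z * s + A12 z * t, A21 z * s + A22 z * t))) (at z)) \<and>
      continuous_on UNIV A11 \<and> continuous_on UNIV A12 \<and> continuous_on UNIV A21 \<and> continuous_on UNIV A22 \<and>
      (\<forall>z\<in>frontier unit_square. v z = 0) \<and>
      integral unit_square (\<lambda>z. (A11 z)\<^sup>2 + (A12 z)\<^sup>2 + (A21 z)\<^sup>2 + (A22 z)\<^sup>2) \<le> 24 + 256 * (real m)\<^sup>2 \<and>
      (LINT z:unit_square|lborel. \<bar>A11 z + A22 z - (indicator A z - measure lborel A)\<bar>) \<le> \<kappa>"
      using v c v0 l2 by blast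
  qed simp
qed

section \<open>Gaining area\<close>

text \<open>Cauchy-Schwarz in each row. The Frobenius norm serves as \<open>g\<close> because the
  integral of its square is the quantity bounded by Parseval.\<close>

lemma norm_matrix_le_frobenius:
  "norm (a * s + b * t, c * s + d * t) \<le> sqrt (a\<^sup>2 + b\<^sup>2 + c\<^sup>2 + d\<^sup>2) * norm (s, t)" for a b c d s t :: real
proof -
  have cs: "(p * s + q * t)\<^sup>2 \<le> (p\<^sup>2 + q\<^sup>2) * (s\<^sup>2 + t\<^sup>2)" for p q :: real
    using zero_le_power2[of "p * t - q * s"] by (simp add: power2_eq_square algebra_simps)
  have "(a * s + b * t)\<^sup>2 + (c * s + d * t)\<^sup>2 \<le> (a\<^sup>2 + b\<^sup>2 + c\<^sup>2 + d\<^sup>2) * (s\<^sup>2 + t\<^sup>2)"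
    using cs[of a b] cs[of c d] by (simp add: algebra_simps)
  thus ?thesis
    by (simp add: norm_Pair real_sqrt_mult[symmetric])
qed

text \<open>The Jacobian is \<open>1 + \<delta> div v + \<delta>^2 det Dv\<close>. On
  \<open>A\<close> the divergence is close to 1 minus the area of \<open>A\<close>, and the
  determinant is at least minus the squared Frobenius norm. One \<open>e\<close> pays for the area
  of \<open>A\<close> lost to \<open>E\<close>, the other for the first order gain lost
  there.\<close>

lemma measure_gain:
  fixes v :: "real \<times> real \<Rightarrow> real \<times> real"
  assumes A: "A \<in> sets borel" "A \<subseteq> unit_square" and E: "E \<in> sets borel" "measure lborel (A \<inter> E) \<le> e"
    and der: "\<And>z. (v has_derivative (\<lambda>(s,t). (A11 z * s + A12 z * t, A21 z * s + A22 z * t))) (at z)"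
    and c: "continuous_on UNIV A11" "continuous_on UNIV A12" "continuous_on UNIV A21" "continuous_on UNIV A22"
    and l2: "integral unit_square (\<lambda>z. (A11 z)\<^sup>2 + (A12 z)\<^sup>2 + (A21 z)\<^sup>2 + (A22 z)\<^sup>2) \<le> C"
    and div: "(LINT z:unit_square|lborel. \<bar>A11 z + A22 z - (indicator A z - measure lborel A)\<bar>) \<le> \<kappa>"
    and \<delta>: "0 \<le> \<delta>" "\<delta> \<le> 1"
    and inj: "inj_on (\<lambda>z. z + \<delta> *\<^sub>R v z) (A - E)" and im: "(\<lambda>z. z + \<delta> *\<^sub>R v z) ` (A - E) \<in> sets borel"
  shows "measure lborel ((\<lambda>z. z + \<delta> *\<^sub>R v z) ` (A - E)) \<ge>
    measure lborel A + \<delta> * (measure lborel A * (1 - measure lborel A) - \<kappa>) - 2 * e - \<delta>\<^sup>2 * C"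
proof -
  let ?\<alpha> = "measure lborel A"
  let ?h = "\<lambda>z. (A11 z)\<^sup>2 + (A12 z)\<^sup>2 + (A21 z)\<^sup>2 + (A22 z)\<^sup>2"
  let ?r = "\<lambda>z. \<bar>A11 z + A22 z - (indicator A z - ?\<alpha>)\<bar>"
  let ?J = "\<lambda>z. (1 + \<delta> * A11 z) * (1 + \<delta> * A22 z) - (\<delta> * A12 z) * (\<delta> * A21 z)"
  let ?S = "A - E"
  have S: "?S \<in> sets borel" "?S \<subseteq> unit_square" using A E by auto
  have fin: "A \<in> fmeasurable lborel"
    using A emeasure_mono[OF A(2), of lborel] emeasure_unit_square by (auto simp: fmeasurable_def le_less_trans[of _ 1])
  have \<alpha>: "0 \<le> ?\<alpha>" "?\<alpha> \<le> 1"
    using measure_mono_fmeasurable[of A unit_square lborel] A measure_unit_square emeasure_unit_square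
    by (auto simp: fmeasurable_def)
  have dS: "((\<lambda>z. z + \<delta> *\<^sub>R v z) has_derivative
     (\<lambda>(s,t). ((1 + \<delta> * A11 z) * s + (\<delta> * A12 z) * t, (\<delta> * A21 z) * s + (1 + \<delta> * A22 z) * t))) (at z)" for z
  proof -
    have "((\<lambda>z. z + \<delta> *\<^sub>R v z) has_derivative
      (\<lambda>h. h + \<delta> *\<^sub>R (case h of (s,t) \<Rightarrow> (A11 z * s + A12 z * t, A21 z * s + A22 z * t)))) (at z)"
      by (intro has_derivative_add has_derivative_ident has_derivative_scaleR_right der)
    thus ?thesis
      by (rule has_derivative_eq_rhs) (auto simp: fun_eq_iff algebra_simps)
  qed
  have iJ: "set_integrable lborel ?S ?J"
    using S by (intro set_integrable_subset[OF set_integrable_unit_square[of ?J]] continuous_intros c) auto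
  have ih: "set_integrable lborel unit_square ?h"
    by (intro set_integrable_unit_square continuous_intros c)
  have ir: "set_integrable lborel unit_square ?r"
    by (intro set_integrable_abs set_integral_diff(1) set_integrable_indicator_unit_square A
        set_integrable_unit_square continuous_intros c)
  note iS = set_integrable_indicator_unit_square[OF S(1)]
  have pw: "1 + \<delta> * (1 - ?\<alpha>) - \<delta> * ?r z - \<delta>\<^sup>2 * ?h z \<le> \<bar>?J z\<bar>" if "z \<in> ?S" for z
  proof -
    have "\<delta> * (1 - ?\<alpha>) - \<delta> * ?r z \<le> \<delta> * (A11 z + A22 z)"
      using that \<delta> by (simp add: right_diff_distrib[symmetric] mult_left_mono)
    moreover have "- ?h z \<le> A11 z * A22 z - A12 z * A21 z"
    proof -
      \<comment> \<open>The right-hand side is twice the sum of \<open>?h z\<close> and the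
        determinant.\<close>
      have "0 \<le> (A11 z + A22 z)\<^sup>2 + (A12 z - A21 z)\<^sup>2 + ?h z" by (intro add_nonneg_nonneg) auto
      thus ?thesis by (simp add: power2_sum power2_diff)
    qed
    hence "\<delta>\<^sup>2 * - ?h z \<le> \<delta>\<^sup>2 * (A11 z * A22 z - A12 z * A21 z)"
      by (rule mult_left_mono) simp
    moreover have "?J z = 1 + \<delta> * (A11 z + A22 z) + \<delta>\<^sup>2 * (A11 z * A22 z - A12 z * A21 z)"
      by (simp add: algebra_simps power2_eq_square)
    ultimately show ?thesis by linarith
  qed
  have mS: "?\<alpha> - e \<le> measure lborel ?S"
  proof -
    have "measure lborel (A - A \<inter> E) = ?\<alpha> - measure lborel (A \<inter> E)"
      using fmeasurableD2[OF fin] A(1) E(1) by (intro measure_Diff) auto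
    moreover have "A - A \<inter> E = ?S" by auto
    ultimately show ?thesis using E(2) by simp
  qed
  have e: "0 \<le> e" using E(2) measure_nonneg[of lborel "A \<inter> E"] by linarith
  have "(1 + \<delta> * (1 - ?\<alpha>)) * (?\<alpha> - e) - \<delta> * \<kappa> - \<delta>\<^sup>2 * C \<le>
     (1 + \<delta> * (1 - ?\<alpha>)) * measure lborel ?S - \<delta> * (LINT z:unit_square|lborel. ?r z) - \<delta>\<^sup>2 * (LINT z:unit_square|lborel. ?h z)"
    using mS div l2 set_borel_integral_eq_integral(2)[OF ih] \<delta> \<alpha>
    by (intro diff_mono mult_left_mono) auto
  also have "\<dots> = (LINT z:unit_square|lborel. (1 + \<delta> * (1 - ?\<alpha>)) * indicator ?S z - \<delta> * ?r z - \<delta>\<^sup>2 * ?h z)"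
    using iS ir ih set_integral_indicator_unit_square[OF S]
    by (simp add: set_integral_diff set_integral_mult_right)
  \<comment> \<open>Off \<open>?S\<close> only the two error terms are left, and they enter with a
    negative sign; so integrating them over the whole square keeps this a lower bound.\<close>
  also have "\<dots> \<le> (LINT z:?S|lborel. \<bar>?J z\<bar>)"
    unfolding set_lebesgue_integral_def
  proof (rule integral_mono)
    show "integrable lborel (\<lambda>z. indicator unit_square z *\<^sub>R ((1 + \<delta> * (1 - ?\<alpha>)) * indicator ?S z - \<delta> * ?r z - \<delta>\<^sup>2 * ?h z))"
      using iS ir ih unfolding set_integrable_def[symmetric] by (intro set_integral_diff(1) set_integrable_mult_right) auto
    show "integrable lborel (\<lambda>z. indicator ?S z *\<^sub>R \<bar>?J z\<bar>)"
      using set_integrable_abs[OF iJ] unfolding set_integrable_def .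
    fix z
    have "0 \<le> \<delta> * ?r z" "0 \<le> \<delta>\<^sup>2 * ?h z" using \<delta> by auto
    hence neg: "indicator unit_square z * (- (\<delta> * ?r z) - \<delta>\<^sup>2 * ?h z) \<le> 0"
      by (intro mult_nonneg_nonpos) (simp, linarith)
    show "indicator unit_square z *\<^sub>R ((1 + \<delta> * (1 - ?\<alpha>)) * indicator ?S z - \<delta> * ?r z - \<delta>\<^sup>2 * ?h z) \<le> indicator ?S z *\<^sub>R \<bar>?J z\<bar>"
    proof (cases "z \<in> ?S")
      case True
      hence i1: "indicator ?S z = (1::real)" "indicator unit_square z = (1::real)"
        using S(2) by (auto simp del: Diff_iff)
      show ?thesis unfolding i1 using pw[OF True] by (simp only: scaleR_one mult_1_right)
    next
      case False
      hence i0: "indicator ?S z = (0::real)" by (rule indicator_simps(2))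
      show ?thesis unfolding i0 using neg by (simp only: mult_zero_right real_scaleR_def mult_zero_left diff_0)
    qed
  qed
  also have "\<dots> = measure lborel ((\<lambda>z. z + \<delta> *\<^sub>R v z) ` ?S)"
    by (rule measure_image_eq_integral_det[OF S(1) im dS inj iJ, symmetric])
  finally have "(1 + \<delta> * (1 - ?\<alpha>)) * (?\<alpha> - e) - \<delta> * \<kappa> - \<delta>\<^sup>2 * C \<le> measure lborel ((\<lambda>z. z + \<delta> *\<^sub>R v z) ` ?S)" .
  moreover have "\<delta> * (1 - ?\<alpha>) * e \<le> e"
    using \<delta> \<alpha> e by (intro mult_left_le_one_le mult_le_one) auto
  ultimately show ?thesis by (simp add: algebra_simps)
qed

theorem theorem3:
  fixes \<gamma> \<gamma>' \<eta> :: real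
  assumes "0 < \<gamma>" and "\<gamma> < 1 - \<gamma>'" and "1 - \<gamma>' < 1" and "\<eta> > 0"
  shows "\<exists>\<epsilon>>0. \<forall>A. A \<in> sets borel \<and> A \<subseteq> unit_square \<and>
            \<gamma> \<le> measure lborel A \<and> measure lborel A \<le> 1 - \<gamma>' \<longrightarrow>
          (\<exists>\<phi>. bij_betw \<phi> unit_square unit_square \<and>
               bi_lipschitz_on (1 + \<eta>) unit_square \<phi> \<and>
               (\<forall>x\<in>frontier unit_square. \<phi> x = x) \<and>
               measure lborel (\<phi> ` A) \<ge> measure lborel A + \<epsilon>)"
proof -
  \<comment> \<open>A lower bound for the area of \<open>A\<close> times that of its complement in
    the square. A quarter of it is allowed as error in the divergence.\<close>
  define g where "g = \<gamma> * \<gamma>'"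
  have g: "0 < g" "g \<le> 1" using assms mult_le_one[of \<gamma> \<gamma>'] by (auto simp: g_def)
  hence g4: "0 < g / 4" by simp
  obtain C0 where C0: "0 \<le> C0" and field: "\<And>A. A \<in> sets borel \<Longrightarrow> A \<subseteq> unit_square \<Longrightarrow>
    \<exists>v A11 A12 A21 A22.
      (\<forall>z. (v has_derivative (\<lambda>(s,t). (A11 z * s + A12 z * t, A21 z * s + A22 z * t))) (at z)) \<and>
      continuous_on UNIV A11 \<and> continuous_on UNIV A12 \<and> continuous_on UNIV A21 \<and> continuous_on UNIV A22 \<and>
      (\<forall>z\<in>frontier unit_square. v z = 0) \<and>
      integral unit_square (\<lambda>z. (A11 z)\<^sup>2 + (A12 z)\<^sup>2 + (A21 z)\<^sup>2 + (A22 z)\<^sup>2) \<le> C0 \<and>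
      (LINT z:unit_square|lborel. \<bar>A11 z + A22 z - (indicator A z - measure lborel A)\<bar>) \<le> g / 4"
    using approximate_divergence_field[OF g4] by blast
  \<comment> \<open>Adding 1 makes \<open>K \<ge> 1\<close> even when \<open>C0\<close> is
    0.\<close>
  define C where "C = C0 + 1"
  have C: "1 \<le> C" "C0 \<le> C" using C0 by (auto simp: C_def)
  \<comment> \<open>Chosen so that \<open>1 - \<sigma>\<close> is exactly
    \<open>1 / (1 + \<eta>)\<close>; the lower bi-Lipschitz bound is the more demanding one.\<close>
  define \<sigma> where "\<sigma> = \<eta> / (1 + \<eta>)"
  have \<sigma>: "0 < \<sigma>" "\<sigma> < 1" "\<sigma> \<le> \<eta>" "1 - \<sigma> = 1 / (1 + \<eta>)"
    using assms(4) by (auto simp: \<sigma>_def field_simps)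
  \<comment> \<open>51 is 2 * 25 + 1: \<open>e\<close> carries the Vitali factor 5^2 and is lost
    twice, and \<open>\<delta>^2 C \<le> C / K^2\<close> adds one. With 512 the losses are at most
    \<open>g * \<sigma> / (512 * K)\<close>, two thirds of the first order gain
    \<open>3 * g * \<sigma> / (1024 * K)\<close>.\<close>
  define K where "K = 512 * 51 * C / (g * \<sigma>)"
  have K1: "1 \<le> K"
  proof -
    have "g * \<sigma> \<le> 1" using g \<sigma> by (intro mult_le_one) auto
    thus ?thesis using g \<sigma> C by (simp add: K_def field_simps)
  qed
  \<comment> \<open>In dimension 2 the field has Lipschitz constant 2 * 8^2 * K = 128 * K where it
    is kept, and its extension has twice that; \<open>\<delta>\<close> scales this to
    \<open>\<sigma>\<close>.\<close>
  define \<delta> where "\<delta> = \<sigma> / (256 * K)"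
  have \<delta>: "0 < \<delta>" "\<delta> \<le> 1" using \<sigma> K1 by (auto simp: \<delta>_def field_simps)
  define e where "e = 25 * C / K\<^sup>2"
  define \<epsilon> where "\<epsilon> = \<delta> * (g - g / 4) - 2 * e - \<delta>\<^sup>2 * C"
  have "0 < \<epsilon>"
  proof -
    have "51 * C = K * (g * \<sigma>) / 512" using g \<sigma> by (simp add: K_def)
    have "\<delta>\<^sup>2 * C \<le> C / K\<^sup>2"
    proof -
      have "\<delta> \<le> 1 / K" using \<sigma> K1 by (simp add: \<delta>_def field_simps)
      hence "\<delta>\<^sup>2 \<le> (1 / K)\<^sup>2" using \<delta> by (intro power_mono) auto
      hence "\<delta>\<^sup>2 * C \<le> (1 / K)\<^sup>2 * C" using C by (intro mult_right_mono) auto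
      thus ?thesis by (simp add: power_divide)
    qed
    hence "2 * e + \<delta>\<^sup>2 * C \<le> 51 * C / K\<^sup>2" by (simp add: e_def add_divide_distrib[symmetric])
    also have "51 * C / K\<^sup>2 = (g * \<sigma>) / (512 * K)"
      unfolding \<open>51 * C = K * (g * \<sigma>) / 512\<close> using K1 by (simp add: power2_eq_square)
    also have "\<dots> < 3 * (g * \<sigma>) / (1024 * K)" using g \<sigma> K1 by (simp add: field_simps)
    also have "\<dots> = \<delta> * (g - g / 4)" by (simp add: \<delta>_def)
    finally show ?thesis unfolding \<epsilon>_def by linarith
  qed
  have "\<exists>\<phi>. bij_betw \<phi> unit_square unit_square \<and> bi_lipschitz_on (1 + \<eta>) unit_square \<phi> \<and>
      (\<forall>x\<in>frontier unit_square. \<phi> x = x) \<and> measure lborel (\<phi> ` A) \<ge> measure lborel A + \<epsilon>"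
    if A: "A \<in> sets borel" "A \<subseteq> unit_square" and \<alpha>: "\<gamma> \<le> measure lborel A" "measure lborel A \<le> 1 - \<gamma>'" for A
  proof -
    obtain v A11 A12 A21 A22 where
      der: "\<And>z. (v has_derivative (\<lambda>(s,t). (A11 z * s + A12 z * t, A21 z * s + A22 z * t))) (at z)"
      and c: "continuous_on UNIV A11" "continuous_on UNIV A12" "continuous_on UNIV A21" "continuous_on UNIV A22"
      and v0: "\<And>z. z \<in> frontier unit_square \<Longrightarrow> v z = 0"
      and l20: "integral unit_square (\<lambda>z. (A11 z)\<^sup>2 + (A12 z)\<^sup>2 + (A21 z)\<^sup>2 + (A22 z)\<^sup>2) \<le> C0"
      and div: "(LINT z:unit_square|lborel. \<bar>A11 z + A22 z - (indicator A z - measure lborel A)\<bar>) \<le> g / 4"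
      using field[OF A] by blast
    let ?h = "\<lambda>z. (A11 z)\<^sup>2 + (A12 z)\<^sup>2 + (A21 z)\<^sup>2 + (A22 z)\<^sup>2"
    have l2: "integral unit_square ?h \<le> C" using l20 C(2) by linarith
    have h0: "0 \<le> ?h z" for z by (intro add_nonneg_nonneg) auto
    interpret V: vanishing_field v "\<lambda>z (s,t). (A11 z * s + A12 z * t, A21 z * s + A22 z * t)"
      "\<lambda>z. sqrt (?h z)" unit_square
    proof
      show "interior unit_square \<noteq> {}"
        by (simp add: unit_square_def box_ne_empty Basis_prod_def ball_Un)
      show "norm ((\<lambda>(s,t). (A11 z * s + A12 z * t, A21 z * s + A22 z * t)) u) \<le> sqrt (?h z) * norm u" for z u
        using norm_matrix_le_frobenius by (cases u) auto
      show "continuous_on UNIV (\<lambda>z. sqrt (?h z))" by (intro continuous_intros c)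
      show "0 \<le> sqrt (?h z)" for z using h0 by simp
      show "convex unit_square" "closed unit_square"
        unfolding unit_square_def by (rule convex_box closed_cbox)+
    qed (fact der v0)+
    have "(\<integral>\<^sup>+ z. ennreal ((sqrt (?h z))\<^sup>2) * indicator unit_square z \<partial>lborel) =
        ennreal (integral unit_square ?h)"
      unfolding real_sqrt_pow2[OF h0]
      by (intro nn_integral_has_integral_lebesgue' integrable_integral
         integrable_on_unit_square continuous_intros c h0)
    also have "\<dots> \<le> ennreal C" using l2 by (rule ennreal_leI)
    finally obtain E where E: "E \<in> sets borel"
      "emeasure lborel E \<le> ennreal (5 ^ DIM(real \<times> real) * C / K\<^sup>2)" "unit_square - E \<subseteq> V.good K"
      by (rule V.bad_set_small) (use C K1 in auto)
    have Ee: "measure lborel (A \<inter> E) \<le> e"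
    proof -
      have "emeasure lborel (A \<inter> E) \<le> emeasure lborel E"
        using E(1) by (intro emeasure_mono) auto
      also have "\<dots> \<le> ennreal e"
        using E(2) by (simp add: e_def)
      finally have "emeasure lborel (A \<inter> E) \<le> ennreal e" .
      thus ?thesis
        unfolding measure_def by (rule enn2real_leI[rotated]) (use C in \<open>simp add: e_def\<close>)
    qed
    \<comment> \<open>The field is kept where its Lipschitz bound is known and is 0 off the open
      square, including those frontier points that happen to lie in \<open>E\<close>.\<close>
    define S where "S = (unit_square - E) \<union> (- interior unit_square)"
    have w0: "V.w z = 0" if "z \<notin> interior unit_square" for z
      using that v0[of z] by (auto simp: V.w_def frontier_def V.closed_Q)
    have lipS: "norm (V.w x - V.w y) \<le> (128 * K) * dist x y" if xy: "x \<in> S" "y \<in> S" for x y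
    proof -
      have K: "0 \<le> K" using K1 by simp
      consider "x \<in> V.good K" "y \<in> V.good K" | "x \<in> V.good K" "y \<notin> interior unit_square"
        | "y \<in> V.good K" "x \<notin> interior unit_square" | "x \<notin> interior unit_square" "y \<notin> interior unit_square"
        using xy E(3) unfolding S_def by blast
      thus ?thesis
      proof cases
        case 1
        thus ?thesis using V.lipschitz_on_good[OF _ _ K] by simp
      next
        case 2
        thus ?thesis using V.lipschitz_good_exterior[OF _ _ K] w0 by simp
      next
        case 3
        thus ?thesis using V.lipschitz_good_exterior[OF _ _ K, of y x] w0 by (simp add: dist_commute)
      next
        case 4
        thus ?thesis using w0 K by simp
      qed
    qed
    have "(2, 2) \<in> S" by (auto simp: S_def unit_square_def mem_box Basis_prod_def)
    hence Sne: "S \<noteq> {}" by auto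
    have L0: "0 \<le> 128 * K" using K1 by simp
    obtain W where W: "\<And>x. x \<in> S \<Longrightarrow> W x = V.w x" "\<And>x y. norm (W x - W y) \<le> 2 * (128 * K) * dist x y"
      using lipschitz_extension_prod[OF Sne L0 lipS] by blast
    interpret P: identity_perturbation "\<lambda>z. \<delta> *\<^sub>R W z" \<sigma>
    proof
      fix x y
      have "norm (\<delta> *\<^sub>R W x - \<delta> *\<^sub>R W y) = \<delta> * norm (W x - W y)"
        using \<delta> by (simp flip: scaleR_diff_right)
      also have "\<dots> \<le> \<delta> * (2 * (128 * K) * dist x y)" using \<delta> W(2) by (intro mult_left_mono) auto
      also have "\<dots> = \<sigma> * dist x y" using K1 by (simp add: \<delta>_def)
      finally show "norm (\<delta> *\<^sub>R W x - \<delta> *\<^sub>R W y) \<le> \<sigma> * dist x y" .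
    qed (use \<sigma> in auto)
    have W0: "W z = 0" if "z \<notin> interior unit_square" for z
      using that w0 W(1)[of z] by (simp add: S_def)
    have eq: "P.\<phi> z = z + \<delta> *\<^sub>R v z" if "z \<in> A - E" for z
      using that A(2) W(1)[of z] by (auto simp: P.\<phi>_def S_def V.w_def)
    have bij: "bij_betw P.\<phi> unit_square unit_square"
      using W0 interior_subset by (intro P.bij_betw_support) auto
    have imeq: "(\<lambda>z. z + \<delta> *\<^sub>R v z) ` (A - E) = P.\<phi> ` (A - E)"
      using eq by (intro image_cong) auto
    have "measure lborel A + \<epsilon> \<le> measure lborel A + \<delta> * (measure lborel A * (1 - measure lborel A) - g / 4) - 2 * e - \<delta>\<^sup>2 * C"
    proof -
      have "g \<le> measure lborel A * (1 - measure lborel A)"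
        unfolding g_def using assms \<alpha> by (intro mult_mono) auto
      hence "\<delta> * (g - g / 4) \<le> \<delta> * (measure lborel A * (1 - measure lborel A) - g / 4)"
        using \<delta> by (intro mult_left_mono) auto
      thus ?thesis by (simp add: \<epsilon>_def)
    qed
    also have "\<dots> \<le> measure lborel ((\<lambda>z. z + \<delta> *\<^sub>R v z) ` (A - E))"
    proof (rule measure_gain[OF A E(1) Ee der c l2 div])
      show "inj_on (\<lambda>z. z + \<delta> *\<^sub>R v z) (A - E)"
        by (subst inj_on_cong[OF eq, symmetric]) (assumption, rule inj_on_subset[OF bij_is_inj[OF P.bij] subset_UNIV])
      show "(\<lambda>z. z + \<delta> *\<^sub>R v z) ` (A - E) \<in> sets borel"
        unfolding imeq using A E by (intro P.image_borel) auto
    qed (use \<delta> in auto)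
    \<comment> \<open>The image of \<open>A \<inter> E\<close> can only add area.\<close>
    also have "\<dots> \<le> measure lborel (P.\<phi> ` A)"
    proof -
      have "P.\<phi> ` A \<subseteq> unit_square" using bij A(2) by (auto simp: bij_betw_def)
      hence "emeasure lborel (P.\<phi> ` A) \<le> 1"
        using emeasure_mono[of "P.\<phi> ` A" unit_square lborel] emeasure_unit_square by simp
      hence "P.\<phi> ` A \<in> fmeasurable lborel"
        using P.image_borel[OF A(1)] by (auto simp: fmeasurable_def intro: le_less_trans)
      thus ?thesis
        unfolding imeq using P.image_borel[of "A - E"] A E by (intro measure_mono_fmeasurable) auto
    qed
    finally have gain: "measure lborel A + \<epsilon> \<le> measure lborel (P.\<phi> ` A)" .
    have "bi_lipschitz_on (1 + \<eta>) unit_square P.\<phi>"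
      unfolding bi_lipschitz_on_def
    proof (intro ballI conjI)
      fix x y
      show "dist x y / (1 + \<eta>) \<le> dist (P.\<phi> x) (P.\<phi> y)"
        using P.dist_ge[of x y] \<sigma>(4) by simp
      have "(1 + \<sigma>) * dist x y \<le> (1 + \<eta>) * dist x y" using \<sigma> by (intro mult_right_mono) auto
      thus "dist (P.\<phi> x) (P.\<phi> y) \<le> (1 + \<eta>) * dist x y"
        using P.dist_le[of x y] by linarith
    qed
    moreover have "\<forall>x\<in>frontier unit_square. P.\<phi> x = x"
      using W0 by (auto simp: P.\<phi>_def frontier_def)
    ultimately show ?thesis using bij gain by blast
  qed
  with \<open>0 < \<epsilon>\<close> show ?thesis by blast
qed

end
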